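(* Let $S\subseteq\Sigma_{io}^*$ be a regular language with $\mathit{shift}(S)<\infty$ and let $T\subseteq\Sigma_{io}^*$ be an arbitrary regular language. Then it is decidable whether there exists a language $U\subseteq T$ recognized by a sequential DFA such that $[\![U]\!]$ is a uniformization of $[\![S]\!]$.
   Context: $\Sigma_{io}=\{1,2\}\times\Sigma$ for a finite alphabet $\Sigma$, $\Sigma_i=\{1\}\times\Sigma$, $\Sigma_o=\{2\}\times\Sigma$. $[\![w]\!]=(\pi_i(w),\pi_o(w))$ where $\pi_i$ keeps the letters $a$ of pairs $(1,a)$ and erases the others, $\pi_o$ keeps the letters $a$ of pairs $(2,a)$ and erases the others; $[\![S]\!]=\{[\![w]\!]:w\in S\}$. For $w=(i_1,a_1)\cdots(i_m,a_m)$, a shift is a position $j<m$ with $i_j\ne i_{j+1}$; $\mathit{shift}(w)$ is the number of shifts and $\mathit{shift}(S)=\sup_{w\in S}\mathit{shift}(w)$. A uniformization of $R$ is a functional $R_f\subseteq R$ with $\mathrm{dom}(R_f)=\mathrm{dom}(R)$. A DFA over $\Sigma_{io}$ is sequential if the states with outgoing $\Sigma_i$-transitions and the states with outgoing $\Sigma_o$-transitions partition the state set and every state of the latter kind has at most one outgoing transition. *)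

theory Defs
  imports Main "HOL-Library.Nat_Bijection"
begin

type_synonym letter = "nat \<times> nat"   \<comment> \<open>(direction 1 = input / 2 = output, symbol)\<close>

definition Sigma_io :: "nat \<Rightarrow> letter set" where
  "Sigma_io k = {1,2} \<times> {0..<k}"

definition proj_i :: "letter list \<Rightarrow> nat list" where
  "proj_i w = map snd (filter (\<lambda>x. fst x = 1) w)"

definition proj_o :: "letter list \<Rightarrow> nat list" where
  "proj_o w = map snd (filter (\<lambda>x. fst x = 2) w)"

definition sem :: "letter list \<Rightarrow> nat list \<times> nat list" where
  "sem w = (proj_i w, proj_o w)"

definition sem_set :: "letter list set \<Rightarrow> (nat list \<times> nat list) set" where
  "sem_set S = sem ` S"

definition shift :: "letter list \<Rightarrow> nat" where
  "shift w = card {j. Suc j < length w \<and> fst (w ! j) \<noteq> fst (w ! Suc j)}"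

definition finite_shift :: "letter list set \<Rightarrow> bool" where
  "finite_shift S \<longleftrightarrow> (\<exists>N. \<forall>w\<in>S. shift w \<le> N)"

definition uniformization :: "('x \<times> 'y) set \<Rightarrow> ('x \<times> 'y) set \<Rightarrow> bool" where
  "uniformization Rf R \<longleftrightarrow> Rf \<subseteq> R \<and> single_valued Rf \<and> Domain Rf = Domain R"

type_synonym dfa = "nat set \<times> nat \<times> (nat \<Rightarrow> letter \<Rightarrow> nat option) \<times> nat set"

fun states :: "dfa \<Rightarrow> nat set" where "states (Q, q0, \<delta>, F) = Q"
fun init :: "dfa \<Rightarrow> nat" where "init (Q, q0, \<delta>, F) = q0"
fun delta :: "dfa \<Rightarrow> nat \<Rightarrow> letter \<Rightarrow> nat option" where "delta (Q, q0, \<delta>, F) = \<delta>"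
fun finals :: "dfa \<Rightarrow> nat set" where "finals (Q, q0, \<delta>, F) = F"

definition dfa_wf :: "nat \<Rightarrow> dfa \<Rightarrow> bool" where
  "dfa_wf k A \<longleftrightarrow> finite (states A) \<and> init A \<in> states A \<and> finals A \<subseteq> states A \<and>
     (\<forall>q x p. delta A q x = Some p \<longrightarrow> q \<in> states A \<and> x \<in> Sigma_io k \<and> p \<in> states A)"

fun steps :: "(nat \<Rightarrow> letter \<Rightarrow> nat option) \<Rightarrow> nat \<Rightarrow> letter list \<Rightarrow> nat option" where
  "steps \<delta> q [] = Some q"
| "steps \<delta> q (x # xs) = (case \<delta> q x of None \<Rightarrow> None | Some p \<Rightarrow> steps \<delta> p xs)"

definition lang :: "dfa \<Rightarrow> letter list set" where
  "lang A = {w. \<exists>q. steps (delta A) (init A) w = Some q \<and> q \<in> finals A}"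

definition sequential :: "dfa \<Rightarrow> bool" where
  "sequential A \<longleftrightarrow> (\<exists>Qi Qo. Qi \<union> Qo = states A \<and> Qi \<inter> Qo = {} \<and>
     (\<forall>q\<in>Qi. \<forall>x. delta A q x \<noteq> None \<longrightarrow> fst x = 1) \<and>
     (\<forall>q\<in>Qo. \<forall>x. delta A q x \<noteq> None \<longrightarrow> fst x = 2) \<and>
     (\<forall>q\<in>Qo. \<forall>x y. delta A q x \<noteq> None \<and> delta A q y \<noteq> None \<longrightarrow> x = y))"

text \<open>A code (n, q0, F, tb) describes states {0..<n}, initial state q0, final states F,
  and the transition table tb: entry at index q*(2*k) + (i-1)*k + a is the target of
  letter (i,a) from q; an entry \<ge> n means "no transition".\<close>
type_synonym dfa_code = "nat \<times> nat \<times> nat list \<times> nat list"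

fun code_valid :: "nat \<Rightarrow> dfa_code \<Rightarrow> bool" where
  "code_valid k (n, q0, F, tb) \<longleftrightarrow> q0 < n \<and> (\<forall>q\<in>set F. q < n) \<and> length tb = n * (2 * k)"

fun dfa_of :: "nat \<Rightarrow> dfa_code \<Rightarrow> dfa" where
  "dfa_of k (n, q0, F, tb) =
     ({0..<n}, q0,
      (\<lambda>q (i, a). if q < n \<and> i \<in> {1,2} \<and> a < k \<and> tb ! (q * (2 * k) + (i - 1) * k + a) < n
                  then Some (tb ! (q * (2 * k) + (i - 1) * k + a)) else None),
      set F)"

fun encode_code :: "dfa_code \<Rightarrow> nat" where
  "encode_code (n, q0, F, tb) = prod_encode (n, prod_encode (q0, prod_encode (list_encode F, list_encode tb)))"

definition encode_input :: "nat \<Rightarrow> dfa_code \<Rightarrow> dfa_code \<Rightarrow> nat" where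
  "encode_input k cS cT = prod_encode (k, prod_encode (encode_code cS, encode_code cT))"

datatype recf = Z | S | Proj nat | Comp recf "recf list" | Prim recf recf | Mn recf

inductive eval :: "recf \<Rightarrow> nat list \<Rightarrow> nat \<Rightarrow> bool" where
  eval_Z: "eval Z xs 0"
| eval_S: "eval S (x # xs) (Suc x)"
| eval_Proj: "i < length xs \<Longrightarrow> eval (Proj i) xs (xs ! i)"
| eval_Comp: "list_all2 (\<lambda>g y. eval g xs y) gs ys \<Longrightarrow> eval f ys z \<Longrightarrow> eval (Comp f gs) xs z"
| eval_Prim0: "eval f xs y \<Longrightarrow> eval (Prim f g) (0 # xs) y"
| eval_PrimS: "eval (Prim f g) (n # xs) y \<Longrightarrow> eval g (n # y # xs) z \<Longrightarrow> eval (Prim f g) (Suc n # xs) z"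
| eval_Mn: "eval f (n # xs) 0 \<Longrightarrow> (\<forall>m<n. \<exists>y. eval f (m # xs) (Suc y)) \<Longrightarrow> eval (Mn f) xs n"

end

theory Submission
  imports Defs "HOL-Library.Sublist"
begin

text \<open>
  A language of finite shift denotes a recognizable relation. If three shifts of an accepting run of
  the \<open>n\<close>-state automaton of \<open>S\<close> occurred at the same state, then the loop between the outer two would
  contain a shift, and pumping it would make the number of shifts unbounded; hence every word of \<open>S\<close> splits
  into at most \<open>2n + 1\<close> maximal blocks of one direction. Membership of \<open>sem w\<close> in \<open>sem_set S\<close> is
  therefore witnessed by a bounded tuple of cut states, and for a fixed tuple the input and the output
  projection of \<open>w\<close> are parsed independently of each other, by a finite automaton.

  So the set of all \<open>w \<in> T\<close> with \<open>sem w \<in> sem_set S\<close> and the domain of \<open>sem_set S\<close> are regular, and a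
  sequential uniformizer is a strategy in a finite safety game: after each input letter the output
  player writes a finite word and, if the input read so far lies in the domain, passes a position
  where the word read so far is in that set. A uniformizer exists iff some set of positions containing
  the initial one is closed under this requirement. All objects of the game are coded by numbers below
  computable bounds, so this condition is a formula with bounded quantifiers only, which is decided
  by a recursive function.
\<close>

section \<open>Recursive functions and bounded quantifiers\<close>

text \<open>\<open>sem\<close> forgets how inputs and outputs interleave, whereas \<open>T\<close>
  and a strategy depend on it: relative to a word of \<open>S\<close> with the same meaning, the
  outputs may run ahead or fall behind by any amount. If \<open>S\<close> repeats one input and one
  output, deciding \<open>sem w \<in> sem_set S\<close> already means comparing unbounded counts;
  finite shift rules this out. Guessed cut states then let each projection be checked at its own
  pace, and only the two ends have to match.

  The uniformizer must be functional and still may write after accepting, before the next input. So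
  an answer has two parts, separated by the one point at which the word counts as accepted. Inputs
  that are no longer prefixes of domain elements are left unanswered, and the safety condition
  concerns what remains. Positions are sets of nodes because the strategy follows one determined
  word, while guesses are resolved only at its end. Answers of any length are replaced by
  reachability among positions, and reachability by membership in all closed sets, whose codes are
  bounded.\<close>

text \<open>Environments are functions so that a bounded quantifier can bind variable \<open>0\<close> and shift the
  others by \<open>Suc\<close>, which matches the goals produced by unification with the rules below.\<close>

definition computable :: "nat \<Rightarrow> ((nat \<Rightarrow> nat) \<Rightarrow> nat) \<Rightarrow> bool" where
  "computable m g \<longleftrightarrow> (\<exists>f. \<forall>e. eval f (map e [0..<m]) (g e))"

definition decidable :: "nat \<Rightarrow> ((nat \<Rightarrow> nat) \<Rightarrow> bool) \<Rightarrow> bool" where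
  "decidable m P \<longleftrightarrow> computable m (\<lambda>e. if P e then 1 else 0)"

lemma computable_comp:
  assumes "computable n G" and "\<And>i. i < n \<Longrightarrow> computable m (gs i)"
  shows "computable m (\<lambda>e. G (\<lambda>i. gs i e))"
proof -
  obtain f where f: "\<And>e. eval f (map e [0..<n]) (G e)" using assms(1) by (auto simp: computable_def)
  have "\<forall>i. \<exists>h. i < n \<longrightarrow> (\<forall>e. eval h (map e [0..<m]) (gs i e))" using assms(2)
    by (auto simp: computable_def)
  then obtain F where F: "\<And>i e. i < n \<Longrightarrow> eval (F i) (map e [0..<m]) (gs i e)" by metis
  have "eval (Comp f (map F [0..<n])) (map e [0..<m]) (G (\<lambda>i. gs i e))" for e
  proof (rule eval_Comp)
    show "list_all2 (\<lambda>g y. eval g (map e [0..<m]) y) (map F [0..<n]) (map (\<lambda>i. gs i e) [0..<n])"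
      using F by (simp add: list_all2_conv_all_nth)
  qed (rule f)
  then show ?thesis unfolding computable_def by blast
qed

lemma computable_var:
  assumes "i < m" shows "computable m (\<lambda>e. e i)"
proof -
  have "eval (Proj i) (map e [0..<m]) (e i)" for e
    using eval_Proj[of i "map e [0..<m]"] assms by simp
  then show ?thesis unfolding computable_def by blast
qed

lemma computable_comp_list:
  assumes "computable (length gs) G" and "list_all (computable m) gs"
  shows "computable m (\<lambda>e. G (\<lambda>i. (gs ! i) e))"
  by (rule computable_comp[OF assms(1), of m "(!) gs"]) (use assms(2) in \<open>auto simp: list_all_length\<close>)

text \<open>The premises of this family mention variables only. A predicate of the game is thus
  shown decidable once, for variable arguments, and then used at arbitrary computable arguments
  without unfolding it again.\<close>

lemma computable_comp1:
  assumes "computable 1 (\<lambda>e. G (e 0))" "computable m a" shows "computable m (\<lambda>e. G (a e))"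
  using computable_comp[OF assms(1), of m "\<lambda>i. a"] assms(2) by simp

lemma computable_comp2:
  assumes "computable 2 (\<lambda>e. G (e 0) (e 1))" "computable m a" "computable m b"
  shows "computable m (\<lambda>e. G (a e) (b e))"
  using computable_comp_list[of "[a, b]" "\<lambda>e. G (e 0) (e 1)" m] assms
  by (simp add: numeral_eq_Suc)

lemma computable_comp3:
  assumes "computable 3 (\<lambda>e. G (e 0) (e 1) (e 2))" "computable m a" "computable m b" "computable m c"
  shows "computable m (\<lambda>e. G (a e) (b e) (c e))"
  using computable_comp_list[of "[a, b, c]" "\<lambda>e. G (e 0) (e 1) (e 2)" m] assms
  by (simp add: numeral_eq_Suc)

lemma computable_comp4:
  assumes "computable 4 (\<lambda>e. G (e 0) (e 1) (e 2) (e 3))"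
    "computable m a" "computable m b" "computable m c" "computable m d"
  shows "computable m (\<lambda>e. G (a e) (b e) (c e) (d e))"
  using computable_comp_list[of "[a, b, c, d]" "\<lambda>e. G (e 0) (e 1) (e 2) (e 3)" m] assms
  by (simp add: numeral_eq_Suc)

lemma computable_comp5:
  assumes "computable 5 (\<lambda>e. G (e 0) (e 1) (e 2) (e 3) (e 4))"
    "computable m a" "computable m b" "computable m c" "computable m d" "computable m a'"
  shows "computable m (\<lambda>e. G (a e) (b e) (c e) (d e) (a' e))"
  using computable_comp_list[of "[a, b, c, d, a']" "\<lambda>e. G (e 0) (e 1) (e 2) (e 3) (e 4)" m] assms
  by (simp add: numeral_eq_Suc)

lemma computable_comp6:
  assumes "computable 6 (\<lambda>e. G (e 0) (e 1) (e 2) (e 3) (e 4) (e 5))"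
    "computable m a" "computable m b" "computable m c" "computable m d" "computable m a'" "computable m b'"
  shows "computable m (\<lambda>e. G (a e) (b e) (c e) (d e) (a' e) (b' e))"
  using computable_comp_list[of "[a, b, c, d, a', b']" "\<lambda>e. G (e 0) (e 1) (e 2) (e 3) (e 4) (e 5)" m] assms
  by (simp add: numeral_eq_Suc)

lemma computable_Suc_var: "computable 1 (\<lambda>e. Suc (e 0))"
  unfolding computable_def by (rule exI[of _ recf.S]) (simp add: eval_S)

lemmas computable_Suc = computable_comp1[of Suc, OF computable_Suc_var]

lemma computable_const: "computable m (\<lambda>e. c)"
proof (induction c)
  case 0
  show ?case unfolding computable_def by (rule exI[of _ Z]) (simp add: eval_Z)
qed (rule computable_Suc)

text \<open>\<open>Prim\<close> recurses on its first argument, so the recursion is carried out with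
  the counter as an additional variable 0, for which \<open>a\<close> is substituted afterwards. In
  the step function, variables 0 and 1 are the counter and the previous value; the parameters move
  up by two.\<close>

lemma computable_rec:
  assumes f: "computable m f" and g: "computable (Suc (Suc m)) (\<lambda>e. g (e 0) (e (Suc 0)) (\<lambda>i. e (Suc (Suc i))))"
    and a: "computable m a"
  shows "computable m (\<lambda>e. rec_nat (f e) (\<lambda>n y. g n y e) (a e))"
proof -
  obtain F where F: "\<And>e. eval F (map e [0..<m]) (f e)" using f by (auto simp: computable_def)
  obtain H where H: "\<And>e. eval H (map e [0..<Suc (Suc m)]) (g (e 0) (e (Suc 0)) (\<lambda>i. e (Suc (Suc i))))"
    using g by (auto simp: computable_def)
  have Hn: "eval H (n # y # map e [0..<m]) (g n y e)" for n y e
    using H[of "case_nat n (case_nat y e)"] by (simp add: map_upt_Suc del: upt_Suc)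
  have "eval (Prim F H) (n # map e [0..<m]) (rec_nat (f e) (\<lambda>n y. g n y e) n)" for n e
    by (induction n) (auto intro: eval_Prim0 eval_PrimS F Hn)
  then have P: "eval (Prim F H) (map e [0..<Suc m])
      (rec_nat (f (\<lambda>i. e (Suc i))) (\<lambda>n y. g n y (\<lambda>i. e (Suc i))) (e 0))" for e
    by (simp add: map_upt_Suc del: upt_Suc)
  have P': "computable (Suc m) (\<lambda>e. rec_nat (f (\<lambda>i. e (Suc i))) (\<lambda>n y. g n y (\<lambda>i. e (Suc i))) (e 0))"
    unfolding computable_def using P by blast
  have "computable m (case_nat a (\<lambda>i e. e i) i)" if "i < Suc m" for i
    using that a by (cases i) (auto intro: computable_var)
  from computable_comp[OF P', of m "case_nat a (\<lambda>i e. e i)", OF this] show ?thesis by simp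
qed

lemma computable_add:
  assumes "computable m a" "computable m b" shows "computable m (\<lambda>e. a e + b e)"
proof -
  have "computable m (\<lambda>e. rec_nat (b e) (\<lambda>n y. Suc y) (a e))"
    by (intro computable_rec assms computable_Suc computable_var) simp_all
  moreover have "rec_nat y (\<lambda>n y. Suc y) x = x + y" for x y :: nat by (induction x) auto
  ultimately show ?thesis by simp
qed

lemma computable_mult:
  assumes "computable m a" "computable m b" shows "computable m (\<lambda>e. a e * b e)"
proof -
  have "computable 2 (\<lambda>e. rec_nat 0 (\<lambda>n y. y + e 1) (e 0))" 
    by (intro computable_rec[where g = "\<lambda>n y e. y + e 1"] computable_const
        computable_add computable_var) simp_all
  moreover have "rec_nat 0 (\<lambda>n z. z + y) x = x * y" for x y :: nat by (induction x) auto
  ultimately have "computable 2 (\<lambda>e. e 0 * e 1)" by simp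
  from computable_comp2[of "(*)", OF this assms] show ?thesis .
qed

lemma computable_power:
  assumes "computable m a" "computable m b" shows "computable m (\<lambda>e. a e ^ b e)"
proof -
  have "computable 2 (\<lambda>e. rec_nat 1 (\<lambda>n y. e 0 * y) (e 1))"
    by (intro computable_rec[where g = "\<lambda>n y e. e 0 * y"] computable_const
        computable_mult computable_var) simp_all
  moreover have "rec_nat (Suc 0) (\<lambda>n z. x * z) y = x ^ y" for x y :: nat by (induction y) auto
  ultimately have "computable 2 (\<lambda>e. e 0 ^ e 1)" by simp
  from computable_comp2[of "(^)", OF this assms] show ?thesis .
qed

lemma computable_diff:
  assumes "computable m a" "computable m b" shows "computable m (\<lambda>e. a e - b e)"
proof -
  \<comment> \<open>Predecessor: the step returns the counter and ignores the previous value.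
    Iterating it gives truncated subtraction.\<close>
  have "computable 1 (\<lambda>e. rec_nat 0 (\<lambda>n y. n) (e 0))"
    by (intro computable_rec[where g = "\<lambda>n y e. n"] computable_const computable_var) simp_all
  moreover have "rec_nat 0 (\<lambda>n y. n) x = x - 1" for x :: nat by (cases x) auto
  ultimately have p: "computable 1 (\<lambda>e. e 0 - 1)" by simp
  have "computable 2 (\<lambda>e. rec_nat (e 0) (\<lambda>n y. y - 1) (e 1))"
    by (intro computable_rec[where g = "\<lambda>n y e. y - 1"] computable_comp1[of "\<lambda>x. x - 1", OF p]
        computable_var) simp_all
  moreover have "rec_nat x (\<lambda>n y. y - 1) y = x - y" for x y :: nat by (induction y) auto
  ultimately have "computable 2 (\<lambda>e. e 0 - e 1)" by simp
  from computable_comp2[of "(-)", OF this assms] show ?thesis .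
qed

section \<open>Connectives, comparisons, bounded quantifiers and minimization\<close>

lemma decidable_not: assumes "decidable m P" shows "decidable m (\<lambda>e. \<not> P e)"
proof -
  have "computable m (\<lambda>e. 1 - (if P e then 1 else 0))" using assms unfolding decidable_def
    by (intro computable_diff computable_const)
  moreover have "(\<lambda>e. 1 - (if P e then 1 else 0)) = (\<lambda>e. if \<not> P e then 1 else 0 :: nat)" by auto
  ultimately show ?thesis unfolding decidable_def by simp
qed

lemma decidable_and: assumes "decidable m P" "decidable m Q" shows "decidable m (\<lambda>e. P e \<and> Q e)"
proof -
  have "computable m (\<lambda>e. (if P e then 1 else 0) * (if Q e then 1 else 0))"
    using assms unfolding decidable_def by (intro computable_mult)
  moreover have "(\<lambda>e. (if P e then 1 else 0) * (if Q e then 1 else 0)) = (\<lambda>e. if P e \<and> Q e then 1 else 0 :: nat)"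
    by auto
  ultimately show ?thesis unfolding decidable_def by simp
qed

lemma decidable_or: assumes "decidable m P" "decidable m Q" shows "decidable m (\<lambda>e. P e \<or> Q e)"
  using decidable_not[OF decidable_and[OF decidable_not[OF assms(1)] decidable_not[OF assms(2)]]] by simp

lemma decidable_imp: assumes "decidable m P" "decidable m Q" shows "decidable m (\<lambda>e. P e \<longrightarrow> Q e)"
  using decidable_or[OF decidable_not[OF assms(1)] assms(2)] by simp

lemma decidable_iff: assumes "decidable m P" "decidable m Q" shows "decidable m (\<lambda>e. P e \<longleftrightarrow> Q e)"
proof -
  have "(\<lambda>e. P e \<longleftrightarrow> Q e) = (\<lambda>e. (P e \<longrightarrow> Q e) \<and> (Q e \<longrightarrow> P e))" by auto
  then show ?thesis using decidable_and[OF decidable_imp[OF assms] decidable_imp[OF assms(2,1)]] by metis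
qed

lemma decidable_less: assumes "computable m a" "computable m b" shows "decidable m (\<lambda>e. a e < b e)"
proof -
  \<comment> \<open>With truncated subtraction, \<open>1 - (1 - d)\<close> is the sign of
    \<open>d\<close>.\<close>
  have "computable m (\<lambda>e. 1 - (1 - (b e - a e)))" by (intro computable_diff computable_const assms)
  moreover have "(\<lambda>e. 1 - (1 - (b e - a e))) = (\<lambda>e. if a e < b e then 1 else 0)" by auto
  ultimately show ?thesis unfolding decidable_def by simp
qed

lemma decidable_eq: assumes "computable m a" "computable m b" shows "decidable m (\<lambda>e. a e = b e)"
proof -
  have "(\<lambda>e. a e = b e) = (\<lambda>e. \<not> a e < b e \<and> \<not> b e < a e)" by auto
  moreover have "decidable m (\<lambda>e. \<not> a e < b e \<and> \<not> b e < a e)"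
    by (intro decidable_and decidable_not decidable_less assms)
  ultimately show ?thesis by simp
qed

lemma computable_if:
  assumes "decidable m P" "computable m a" "computable m b"
  shows "computable m (\<lambda>e. if P e then a e else b e)"
proof -
  have "computable m (\<lambda>e. (if P e then 1 else 0) * a e + (if \<not> P e then 1 else 0) * b e)"
    using assms decidable_not[OF assms(1)] unfolding decidable_def
      by (intro computable_add computable_mult)
  moreover have "(\<lambda>e. (if P e then 1 else 0) * a e + (if \<not> P e then 1 else 0) * b e)
      = (\<lambda>e. if P e then a e else b e)" by auto
  ultimately show ?thesis by simp
qed

lemma decidable_ex:
  assumes "computable m b" "decidable (Suc m) (\<lambda>e. P (e 0) (\<lambda>i. e (Suc i)))"
  shows "decidable m (\<lambda>e. \<exists>y<b e. P y e)"
proof -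
  \<comment> \<open>The step of the recursion below sees the accumulator as variable 1; this
    substitution leaves it out, so that \<open>P\<close> is read at the counter and the original
    environment.\<close>
  have s: "computable (Suc (Suc m)) (case_nat (\<lambda>e. e 0) (\<lambda>i e. e (Suc (Suc i))) i)" if "i < Suc m" for i
    using that by (cases i) (auto intro!: computable_var)
  have "decidable (Suc (Suc m)) (\<lambda>e. P (e 0) (\<lambda>i. e (Suc (Suc i))))"
    using computable_comp[OF assms(2)[unfolded decidable_def], of "Suc (Suc m)" "case_nat (\<lambda>e. e 0) (\<lambda>i e. e (Suc (Suc i)))", OF s]
    by (simp add: decidable_def)
  then have "computable m (\<lambda>e. rec_nat 0 (\<lambda>n y. if P n e then 1 else y) (b e))"
    by (intro computable_rec[where g = "\<lambda>n y e. if P n e then 1 else y"] computable_if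
        computable_const assms computable_var) simp_all
  moreover have "rec_nat 0 (\<lambda>n y. if Q n then 1 else y) b = (if \<exists>y<b. Q y then 1 else 0 :: nat)"
    for Q b by (induction b) (auto simp: less_Suc_eq)
  ultimately show ?thesis by (simp add: decidable_def)
qed

lemma decidable_all:
  assumes "computable m b" "decidable (Suc m) (\<lambda>e. P (e 0) (\<lambda>i. e (Suc i)))"
  shows "decidable m (\<lambda>e. \<forall>y<b e. P y e)"
  using decidable_not[OF decidable_ex[OF assms(1) decidable_not[OF assms(2)]]] by simp

text \<open>\<open>Mn\<close> searches for a zero, so the characteristic function is inverted. The
  search has to stop in every environment, because \<open>computable\<close> demands a value
  everywhere.\<close>

lemma computable_Least:
  assumes P: "decidable (Suc m) (\<lambda>e. P (e 0) (\<lambda>i. e (Suc i)))" and ex: "\<And>e. \<exists>y. P y e"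
  shows "computable m (\<lambda>e. LEAST y. P y e)"
proof -
  have "computable (Suc m) (\<lambda>e. if P (e 0) (\<lambda>i. e (Suc i)) then 0 else 1)"
    using P by (intro computable_if computable_const)
  then obtain f where f: "\<And>e. eval f (map e [0..<Suc m]) (if P (e 0) (\<lambda>i. e (Suc i)) then 0 else 1)"
    by (auto simp: computable_def)
  have fn: "eval f (n # map e [0..<m]) (if P n e then 0 else 1)" for n e
    using f[of "case_nat n e"] by (simp add: map_upt_Suc del: upt_Suc)
  have "eval (Mn f) (map e [0..<m]) (LEAST y. P y e)" for e
  proof (rule eval_Mn)
    show "eval f ((LEAST y. P y e) # map e [0..<m]) 0"
      using fn[of "LEAST y. P y e" e] LeastI_ex[OF ex[of e]] by simp
    show "\<forall>i<LEAST y. P y e. \<exists>y. eval f (i # map e [0..<m]) (Suc y)"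
    proof (intro allI impI)
      fix i assume "i < (LEAST y. P y e)"
      then have "\<not> P i e" by (rule not_less_Least)
      then have "eval f (i # map e [0..<m]) (Suc 0)" using fn[of i e] by simp
      then show "\<exists>y. eval f (i # map e [0..<m]) (Suc y)" by blast
    qed
  qed
  then show ?thesis unfolding computable_def by blast
qed

lemma decidable_comp1:
  assumes "decidable 1 (\<lambda>e. G (e 0))" "computable m a" shows "decidable m (\<lambda>e. G (a e))"
  using computable_comp1[OF assms(1)[unfolded decidable_def] assms(2)] unfolding decidable_def .

lemma decidable_comp2:
  assumes "decidable 2 (\<lambda>e. G (e 0) (e 1))" "computable m a" "computable m b"
  shows "decidable m (\<lambda>e. G (a e) (b e))"
  using computable_comp2[OF assms(1)[unfolded decidable_def] assms(2-)] unfolding decidable_def .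

lemma decidable_comp3:
  assumes "decidable 3 (\<lambda>e. G (e 0) (e 1) (e 2))" "computable m a" "computable m b" "computable m c"
  shows "decidable m (\<lambda>e. G (a e) (b e) (c e))"
  using computable_comp3[OF assms(1)[unfolded decidable_def] assms(2-)] unfolding decidable_def .

lemma decidable_comp4:
  assumes "decidable 4 (\<lambda>e. G (e 0) (e 1) (e 2) (e 3))"
    "computable m a" "computable m b" "computable m c" "computable m d"
  shows "decidable m (\<lambda>e. G (a e) (b e) (c e) (d e))"
  using computable_comp4[OF assms(1)[unfolded decidable_def] assms(2-)] unfolding decidable_def .

lemma decidable_comp5:
  assumes "decidable 5 (\<lambda>e. G (e 0) (e 1) (e 2) (e 3) (e 4))"
    "computable m a" "computable m b" "computable m c" "computable m d" "computable m a'"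
  shows "decidable m (\<lambda>e. G (a e) (b e) (c e) (d e) (a' e))"
  using computable_comp5[OF assms(1)[unfolded decidable_def] assms(2-)] unfolding decidable_def .

lemma decidable_comp6:
  assumes "decidable 6 (\<lambda>e. G (e 0) (e 1) (e 2) (e 3) (e 4) (e 5))"
    "computable m a" "computable m b" "computable m c" "computable m d" "computable m a'" "computable m b'"
  shows "decidable m (\<lambda>e. G (a e) (b e) (c e) (d e) (a' e) (b' e))"
  using computable_comp6[OF assms(1)[unfolded decidable_def] assms(2-)] unfolding decidable_def .

lemma decidable_odd: assumes "computable m a" shows "decidable m (\<lambda>e. odd (a e))"
proof -
  have "computable 1 (\<lambda>e. rec_nat 0 (\<lambda>n y. 1 - y) (e 0))"
    by (intro computable_rec[where g = "\<lambda>n y e. 1 - y"] computable_const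
        computable_diff computable_var) simp_all
  moreover have "rec_nat 0 (\<lambda>n y. 1 - y) x = (if odd x then 1 else 0 :: nat)" for x :: nat
    by (induction x) auto
  ultimately have "decidable 1 (\<lambda>e. odd (e 0))" by (simp add: decidable_def)
  from decidable_comp1[OF this assms] show ?thesis .
qed

lemma computable_div: assumes "computable m a" "computable m b" shows "computable m (\<lambda>e. a e div b e)"
proof -
  \<comment> \<open>The disjunct \<open>y = 0\<close> makes the search stop at 0 for the zero
    divisor, in agreement with \<open>x div 0 = 0\<close>.\<close>
  have *: "x div y = (LEAST z. y = 0 \<or> x < Suc z * y)" for x y :: nat
  proof (rule Least_equality[symmetric])
    show "y = 0 \<or> x < Suc (x div y) * y"
      by (metis dividend_less_div_times gr0I mult_Suc)
    show "x div y \<le> z" if "y = 0 \<or> x < Suc z * y" for z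
      using that by (metis div_by_0 less_Suc_eq_le less_mult_imp_div_less zero_le)
  qed
  have "\<exists>z. y = 0 \<or> x < Suc z * y" for x y :: nat
    by (intro exI[of _ x]) (cases y; simp)
  then have "computable 2 (\<lambda>e. LEAST z. e 1 = 0 \<or> e 0 < Suc z * e 1)"
    by (intro computable_Least decidable_or decidable_eq decidable_less computable_var
        computable_const computable_mult computable_Suc) simp_all
  then have "computable 2 (\<lambda>e. e 0 div e 1)" by (simp add: *)
  from computable_comp2[of "(div)", OF this assms] show ?thesis .
qed

lemma computable_mod: assumes "computable m a" "computable m b" shows "computable m (\<lambda>e. a e mod b e)"
  using assms unfolding modulo_nat_def by (intro computable_diff computable_mult computable_div)

section \<open>The game as a decidable predicate\<close>

lemma computable_pair: assumes "computable m a" "computable m b"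
  shows "computable m (\<lambda>e. prod_encode (a e, b e))"
  unfolding prod_encode_def triangle_def prod.case
  by (intro computable_add computable_div computable_mult computable_Suc computable_const assms)

lemma computable_fst: assumes "computable m a" shows "computable m (\<lambda>e. fst (prod_decode (a e)))"
proof -
  have *: "fst (prod_decode x) = (LEAST y. \<exists>z<Suc x. prod_encode (y, z) = x)" for x
  proof (rule Least_equality[symmetric])
    have "snd (prod_decode x) \<le> x"
      using le_prod_encode_2[of "snd (prod_decode x)" "fst (prod_decode x)"] by simp
    then show "\<exists>z<Suc x. prod_encode (fst (prod_decode x), z) = x"
      by (intro exI[of _ "snd (prod_decode x)"]) simp
  qed auto
  have "\<exists>y. \<exists>z<Suc x. prod_encode (y, z) = x" for x
    by (metis le_imp_less_Suc le_prod_encode_2 prod_decode_inverse surj_pair)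
  then have "computable 1 (\<lambda>e. LEAST y. \<exists>z<Suc (e 0). prod_encode (y, z) = e 0)"
    by (intro computable_Least decidable_ex decidable_eq computable_pair computable_Suc
        computable_var) simp_all
  then have "computable 1 (\<lambda>e. fst (prod_decode (e 0)))" by (simp add: *)
  from computable_comp1[OF this assms] show ?thesis .
qed

lemma computable_snd: assumes "computable m a" shows "computable m (\<lambda>e. snd (prod_decode (a e)))"
proof -
  have *: "snd (prod_decode x) = (LEAST z. prod_encode (fst (prod_decode x), z) = x)" for x
    by (rule Least_equality[symmetric]) (auto, metis order_refl prod_encode_inverse snd_conv)
  have "\<exists>z. prod_encode (fst (prod_decode x), z) = x" for x
    by (metis prod_decode_inverse prod.collapse)
  then have "computable 1 (\<lambda>e. LEAST z. prod_encode (fst (prod_decode (e 0)), z) = e 0)"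
    by (intro computable_Least decidable_eq computable_pair computable_fst computable_var) simp_all
  then have "computable 1 (\<lambda>e. snd (prod_decode (e 0)))" by (simp add: *[symmetric])
  from computable_comp1[OF this assms] show ?thesis .
qed

text \<open>Bit \<open>x\<close> of \<open>X\<close>: membership in the set coded by
  \<open>set_encode\<close>, spelled out arithmetically so that it falls under the decidability
  rules.\<close>

definition mem :: "nat \<Rightarrow> nat \<Rightarrow> bool" where "mem x X \<longleftrightarrow> odd (X div 2 ^ x)"

lemma mem_iff: "mem x X \<longleftrightarrow> x \<in> set_decode X"
  by (simp add: mem_def set_decode_def)

lemma decidable_mem: assumes "computable m a" "computable m b" shows "decidable m (\<lambda>e. mem (a e) (b e))"
  unfolding mem_def by (intro decidable_odd computable_div computable_power computable_const assms)

text \<open>\<open>list_encode\<close> codes the empty list by 0 and a nonempty list by the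
  successor of the pair of its head and the code of its tail. Subtracting 1 and taking the second
  component therefore yields the tail, and 0 stays 0.\<close>

definition code_drop :: "nat \<Rightarrow> nat \<Rightarrow> nat" where
  "code_drop i c = rec_nat c (\<lambda>_ y. snd (prod_decode (y - 1))) i"

definition code_nth :: "nat \<Rightarrow> nat \<Rightarrow> nat" where
  "code_nth i c = fst (prod_decode (code_drop i c - 1))"

text \<open>The code of a list is at least its length, so \<open>c\<close> itself bounds the
  indices; a nonzero \<open>code_drop\<close> says that \<open>i\<close> is an index.\<close>

definition code_mem :: "nat \<Rightarrow> nat \<Rightarrow> bool" where
  "code_mem q c \<longleftrightarrow> (\<exists>i<c. code_drop i c \<noteq> 0 \<and> code_nth i c = q)"

lemma code_drop_list_encode: "code_drop i (list_encode xs) = list_encode (drop i xs)"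
proof (induction i)
  case (Suc i)
  have "prod_decode 0 = (0, 0)"
    using prod_encode_inverse[of "(0, 0)"] by (simp add: prod_encode_def)
  then have "snd (prod_decode (list_encode ys - 1)) = list_encode (tl ys)" for ys
    by (cases ys) simp_all
  then show ?case using Suc by (simp add: code_drop_def drop_Suc tl_drop)
qed (simp add: code_drop_def)

lemma code_nth_list_encode: "i < length xs \<Longrightarrow> code_nth i (list_encode xs) = xs ! i"
  by (cases "drop i xs") (auto simp: code_nth_def code_drop_list_encode hd_drop_conv_nth[symmetric])

lemma list_encode_eq_0: "list_encode xs = 0 \<longleftrightarrow> xs = []"
  by (cases xs) auto

lemma length_le_list_encode: "length xs \<le> list_encode xs"
  by (induction xs) (auto intro: order_trans[OF _ le_prod_encode_2])

lemma code_mem_list_encode: "code_mem q (list_encode xs) \<longleftrightarrow> q \<in> set xs"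
proof
  assume "code_mem q (list_encode xs)"
  then obtain i where "i < length xs" "code_nth i (list_encode xs) = q"
    by (auto simp: code_mem_def code_drop_list_encode list_encode_eq_0 not_le)
  then show "q \<in> set xs" by (auto simp: code_nth_list_encode)
next
  assume "q \<in> set xs"
  then obtain i where "i < length xs" "xs ! i = q" by (auto simp: in_set_conv_nth)
  then show "code_mem q (list_encode xs)" unfolding code_mem_def
    using length_le_list_encode[of xs]
    by (intro exI[of _ i]) (auto simp: code_drop_list_encode code_nth_list_encode list_encode_eq_0)
qed

lemma computable_code_drop: assumes "computable m a" "computable m b"
  shows "computable m (\<lambda>e. code_drop (a e) (b e))"
proof -
  have "computable 2 (\<lambda>e. code_drop (e 0) (e 1))" unfolding code_drop_def
    by (intro computable_rec[where g = "\<lambda>_ y _. snd (prod_decode (y - 1))"]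
        computable_snd computable_diff computable_const computable_var) simp_all
  from computable_comp2[of code_drop, OF this assms] show ?thesis .
qed

lemma computable_code_nth: assumes "computable m a" "computable m b"
  shows "computable m (\<lambda>e. code_nth (a e) (b e))"
  unfolding code_nth_def
    by (intro computable_fst computable_diff computable_code_drop computable_const assms)

lemma decidable_code_mem_vars: "decidable 2 (\<lambda>e. code_mem (e 0) (e 1))"
  unfolding code_mem_def
    by (intro decidable_ex decidable_and decidable_not decidable_eq computable_code_drop computable_code_nth computable_const computable_var) simp_all

lemmas decidable_code_mem = decidable_comp2[of code_mem, OF decidable_code_mem_vars]

section \<open>Arithmetic description of the automata and of the game\<close>

definition num_states :: "nat \<Rightarrow> nat" where "num_states c = fst (prod_decode c)"
definition start_state :: "nat \<Rightarrow> nat" where "start_state c = fst (prod_decode (snd (prod_decode c)))"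
definition final_list :: "nat \<Rightarrow> nat" where
  "final_list c = fst (prod_decode (snd (prod_decode (snd (prod_decode c)))))"
definition table :: "nat \<Rightarrow> nat" where
  "table c = snd (prod_decode (snd (prod_decode (snd (prod_decode c)))))"
definition alph :: "nat \<Rightarrow> nat" where "alph v = fst (prod_decode v)"
definition autS :: "nat \<Rightarrow> nat" where "autS v = fst (prod_decode (snd (prod_decode v)))"
definition autT :: "nat \<Rightarrow> nat" where "autT v = snd (prod_decode (snd (prod_decode v)))"

text \<open>Table entries that are not states stand for missing transitions; the bound on
  \<open>q'\<close> filters them out.\<close>

definition table_trans :: "nat \<Rightarrow> nat \<Rightarrow> nat \<Rightarrow> nat \<Rightarrow> nat \<Rightarrow> nat \<Rightarrow> bool" where
  "table_trans k c q i a q' \<longleftrightarrow> q < num_states c \<and> (i = 1 \<or> i = 2) \<and> a < k \<and> q' < num_states c \<and>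
     code_nth (q * (2 * k) + (i - 1) * k + a) (table c) = q'"

text \<open>The argument \<open>d\<close> restricts the direction of the letters; \<open>d = 0\<close> allows both directions.\<close>

definition reach :: "nat \<Rightarrow> nat \<Rightarrow> nat \<Rightarrow> nat \<Rightarrow> bool" where
  "reach v d q q' \<longleftrightarrow> (\<forall>R<2 ^ num_states (autS v). mem q R \<and>
     (\<forall>x<num_states (autS v). \<forall>y<num_states (autS v). \<forall>i<3. \<forall>a<alph v.
        mem x R \<and> (d = 0 \<or> i = d) \<and> table_trans (alph v) (autS v) x i a y \<longrightarrow> mem y R) \<longrightarrow> mem q' R)"

text \<open>A tuple of states is coded by a number whose base-\<open>n\<close> digits are its entries.\<close>

definition digit :: "nat \<Rightarrow> nat \<Rightarrow> nat \<Rightarrow> nat" where "digit n t j = t div n ^ j mod n"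
text \<open>With at most \<open>2 * n\<close> shifts, \<open>track_complete\<close> yields
  \<open>l \<le> 2 * n + 1\<close>, as it may spend one level more than there are shifts. The last
  block is \<open>l + 1\<close> and ends in entry \<open>l + 2\<close>, so the entries
  \<open>0\<close> to \<open>2 * n + 3\<close> are needed.\<close>

definition cut_bound :: "nat \<Rightarrow> nat" where "cut_bound v = 2 * num_states (autS v) + 4"
definition tuple_bound :: "nat \<Rightarrow> nat" where "tuple_bound v = num_states (autS v) ^ cut_bound v"
definition state_bound :: "nat \<Rightarrow> nat" where
  "state_bound v = num_states (autS v) + num_states (autT v)"
text \<open>The positions of the game are the subsets reached by the powerset construction on an automaton
  with three kinds of nodes. Kind 0 runs the automaton of \<open>T\<close>. Kind 1 runs the automaton of \<open>S\<close> with
  all output letters erased and thus recognizes the domain. Kind 2 guesses a tuple \<open>t\<close> of cut states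
  and parses one direction only: block \<open>l\<close> leads from digit \<open>l\<close> to digit \<open>l + 1\<close> of \<open>t\<close>, even blocks
  consist of inputs and odd blocks of outputs.\<close>

definition node :: "nat \<Rightarrow> nat \<Rightarrow> nat \<Rightarrow> nat \<Rightarrow> nat" where
  "node kd t l q = prod_encode (kd, prod_encode (t, prod_encode (l, q)))"
text \<open>Kind 3 lies above the kinds in use and the pairing function is monotone, so this code
  exceeds all nodes whose components respect their bounds.\<close>

definition node_bound :: "nat \<Rightarrow> nat" where
  "node_bound v = node 3 (tuple_bound v) (cut_bound v) (state_bound v)"

definition nstep_T :: "nat \<Rightarrow> nat \<Rightarrow> nat \<Rightarrow> nat \<Rightarrow> nat \<Rightarrow> bool" where
  "nstep_T v z i a z' \<longleftrightarrow> (\<exists>q<num_states (autT v). \<exists>q'<num_states (autT v).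
     z = node 0 0 0 q \<and> z' = node 0 0 0 q' \<and> table_trans (alph v) (autT v) q i a q')"

text \<open>The closure under outputs is taken after each input letter and, for the empty input, in
  \<open>ninit\<close>; acceptance can then be read off the current states.\<close>

definition nstep_D :: "nat \<Rightarrow> nat \<Rightarrow> nat \<Rightarrow> nat \<Rightarrow> nat \<Rightarrow> bool" where
  "nstep_D v z i a z' \<longleftrightarrow> (\<exists>q<num_states (autS v). \<exists>q'<num_states (autS v).
     z = node 1 0 0 q \<and> z' = node 1 0 0 q' \<and>
     (i = 2 \<and> q' = q \<or>
      i = 1 \<and> (\<exists>p<num_states (autS v). table_trans (alph v) (autS v) q 1 a p \<and> reach v 2 p q')))"

text \<open>A node follows the blocks of one parity. Leaving block \<open>l\<close> requires the
  state in which the tuple lets block \<open>l + 1\<close> begin, and the jump already consumes the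
  first letter of block \<open>l + 2\<close>. Whether block \<open>l + 1\<close> really connects the
  two digits is checked by the node of the other parity.\<close>

definition nstep_cut :: "nat \<Rightarrow> nat \<Rightarrow> nat \<Rightarrow> nat \<Rightarrow> nat \<Rightarrow> bool" where
  "nstep_cut v z i a z' \<longleftrightarrow> (\<exists>t<tuple_bound v. \<exists>l<cut_bound v. \<exists>l'<cut_bound v.
     \<exists>q<num_states (autS v). \<exists>q'<num_states (autS v). z = node 2 t l q \<and> z' = node 2 t l' q' \<and>
       (i \<noteq> Suc (l mod 2) \<and> l' = l \<and> q' = q \<or>
        i = Suc (l mod 2) \<and> l' = l \<and> table_trans (alph v) (autS v) q i a q' \<or>
        i = Suc (l mod 2) \<and> l' = l + 2 \<and> q = digit (num_states (autS v)) t (l + 1) \<and>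
          table_trans (alph v) (autS v) (digit (num_states (autS v)) t (l + 2)) i a q'))"

definition nstep :: "nat \<Rightarrow> nat \<Rightarrow> nat \<Rightarrow> nat \<Rightarrow> nat \<Rightarrow> bool" where
  "nstep v z i a z' \<longleftrightarrow> nstep_T v z i a z' \<or> nstep_D v z i a z' \<or> nstep_cut v z i a z'"

definition ninit :: "nat \<Rightarrow> nat \<Rightarrow> bool" where
  "ninit v z \<longleftrightarrow> z = node 0 0 0 (start_state (autT v)) \<or>
     (\<exists>q<num_states (autS v). reach v 2 (start_state (autS v)) q \<and> z = node 1 0 0 q) \<or>
     (\<exists>t<tuple_bound v. digit (num_states (autS v)) t 0 = start_state (autS v) \<and>
        (z = node 2 t 0 (start_state (autS v)) \<or> z = node 2 t 1 (digit (num_states (autS v)) t 1)))"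

definition pos_init :: "nat \<Rightarrow> nat \<Rightarrow> bool" where
  "pos_init v X \<longleftrightarrow> (\<forall>z<node_bound v. mem z X \<longleftrightarrow> ninit v z)"

definition pos_step :: "nat \<Rightarrow> nat \<Rightarrow> nat \<Rightarrow> nat \<Rightarrow> nat \<Rightarrow> bool" where
  "pos_step v X i a Y \<longleftrightarrow>
     (\<forall>y<node_bound v. mem y Y \<longleftrightarrow> (\<exists>z<node_bound v. mem z X \<and> nstep v z i a y))"

definition pos_T :: "nat \<Rightarrow> nat \<Rightarrow> bool" where
  "pos_T v X \<longleftrightarrow> (\<exists>p<num_states (autT v). mem (node 0 0 0 p) X \<and> code_mem p (final_list (autT v)))"

text \<open>The two parsers of the same guess must meet: one has finished block \<open>l\<close>
  where block \<open>l + 1\<close> begins, the other has finished block \<open>l + 1\<close>, the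
  last one, in a final state. The parity of \<open>l\<close> is open because a word may end in
  either direction.\<close>

definition pos_S :: "nat \<Rightarrow> nat \<Rightarrow> bool" where
  "pos_S v X \<longleftrightarrow> (\<exists>t<tuple_bound v. \<exists>l<cut_bound v.
     mem (node 2 t l (digit (num_states (autS v)) t (l + 1))) X \<and>
     mem (node 2 t (l + 1) (digit (num_states (autS v)) t (l + 2))) X \<and>
     code_mem (digit (num_states (autS v)) t (l + 2)) (final_list (autS v)))"

definition pos_D :: "nat \<Rightarrow> nat \<Rightarrow> bool" where
  "pos_D v X \<longleftrightarrow> (\<exists>q<num_states (autS v). mem (node 1 0 0 q) X \<and> code_mem q (final_list (autS v)))"

text \<open>The closure uses both directions: some run of the automaton of \<open>S\<close> on the
  inputs read so far can be completed to an accepting one.\<close>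

definition pos_useful :: "nat \<Rightarrow> nat \<Rightarrow> bool" where
  "pos_useful v X \<longleftrightarrow> (\<exists>q<num_states (autS v). \<exists>q'<num_states (autS v).
     mem (node 1 0 0 q) X \<and> reach v 0 q q' \<and> code_mem q' (final_list (autS v)))"

definition pos_reach :: "nat \<Rightarrow> nat \<Rightarrow> nat \<Rightarrow> bool" where
  "pos_reach v X X' \<longleftrightarrow> (\<forall>R<2 ^ 2 ^ node_bound v. mem X R \<and>
     (\<forall>Y<2 ^ node_bound v. \<forall>Y'<2 ^ node_bound v. \<forall>b<alph v.
        mem Y R \<and> pos_step v Y 2 b Y' \<longrightarrow> mem Y' R) \<longrightarrow> mem X' R)"

text \<open>\<open>X1\<close> is the position at the accepting point, \<open>X2\<close> the one
  where the next input is awaited. An input letter after which no domain element is possible any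
  more demands no successor in \<open>W\<close>.\<close>

definition pos_good :: "nat \<Rightarrow> nat \<Rightarrow> nat \<Rightarrow> bool" where
  "pos_good v W X \<longleftrightarrow> (\<exists>X1<2 ^ node_bound v. \<exists>X2<2 ^ node_bound v.
     pos_reach v X X1 \<and> pos_reach v X1 X2 \<and> (pos_D v X \<longrightarrow> pos_T v X1 \<and> pos_S v X1) \<and>
     (\<forall>a<alph v. \<forall>Y<2 ^ node_bound v. pos_step v X2 1 a Y \<and> pos_useful v Y \<longrightarrow> mem Y W))"

definition winning :: "nat \<Rightarrow> bool" where
  "winning v \<longleftrightarrow> (\<exists>W<2 ^ 2 ^ node_bound v.
     (\<exists>X<2 ^ node_bound v. pos_init v X \<and> mem X W) \<and>
     (\<forall>X<2 ^ node_bound v. mem X W \<longrightarrow> pos_good v W X))"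

section \<open>Decidability of the conditions of the game\<close>

lemmas basic_rules = decidable_ex decidable_all decidable_and decidable_or decidable_imp
  decidable_iff decidable_not decidable_less decidable_eq decidable_mem decidable_code_mem
  computable_code_nth computable_pair computable_fst computable_snd computable_add computable_mult
  computable_diff computable_div computable_mod computable_power computable_Suc computable_const
  computable_var

lemma computable_num_states: "computable m a \<Longrightarrow> computable m (\<lambda>e. num_states (a e))"
  unfolding num_states_def by (intro basic_rules)
lemma computable_start_state: "computable m a \<Longrightarrow> computable m (\<lambda>e. start_state (a e))"
  unfolding start_state_def by (intro basic_rules)
lemma computable_final_list: "computable m a \<Longrightarrow> computable m (\<lambda>e. final_list (a e))"
  unfolding final_list_def by (intro basic_rules)
lemma computable_table: "computable m a \<Longrightarrow> computable m (\<lambda>e. table (a e))"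
  unfolding table_def by (intro basic_rules)
lemma computable_alph: "computable m a \<Longrightarrow> computable m (\<lambda>e. alph (a e))"
  unfolding alph_def by (intro basic_rules)
lemma computable_autS: "computable m a \<Longrightarrow> computable m (\<lambda>e. autS (a e))"
  unfolding autS_def by (intro basic_rules)
lemma computable_autT: "computable m a \<Longrightarrow> computable m (\<lambda>e. autT (a e))"
  unfolding autT_def by (intro basic_rules)
lemma computable_digit: "computable m a \<Longrightarrow> computable m b \<Longrightarrow> computable m c \<Longrightarrow> computable m (\<lambda>e. digit (a e) (b e) (c e))"
  unfolding digit_def by (intro basic_rules)
lemma computable_node: "computable m a \<Longrightarrow> computable m b \<Longrightarrow> computable m c \<Longrightarrow> computable m d \<Longrightarrow> computable m (\<lambda>e. node (a e) (b e) (c e) (d e))"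
  unfolding node_def by (intro basic_rules)

lemmas access_rules = basic_rules computable_num_states computable_start_state computable_final_list
  computable_table computable_alph computable_autS computable_autT
  computable_digit computable_node

lemma computable_cut_bound: "computable m a \<Longrightarrow> computable m (\<lambda>e. cut_bound (a e))"
  unfolding cut_bound_def by (intro access_rules)
lemma computable_tuple_bound: "computable m a \<Longrightarrow> computable m (\<lambda>e. tuple_bound (a e))"
  unfolding tuple_bound_def by (intro access_rules computable_cut_bound)
lemma computable_state_bound: "computable m a \<Longrightarrow> computable m (\<lambda>e. state_bound (a e))"
  unfolding state_bound_def by (intro access_rules)
lemma computable_node_bound: "computable m a \<Longrightarrow> computable m (\<lambda>e. node_bound (a e))"
  unfolding node_bound_def
    by (intro access_rules computable_cut_bound computable_tuple_bound computable_state_bound)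

lemmas bound_rules = access_rules computable_cut_bound computable_tuple_bound computable_node_bound

lemma decidable_table_trans_vars: "decidable 6 (\<lambda>e. table_trans (e 0) (e 1) (e 2) (e 3) (e 4) (e 5))"
  unfolding table_trans_def by (intro bound_rules) simp_all
lemmas decidable_table_trans = decidable_comp6[of table_trans, OF decidable_table_trans_vars]

lemma decidable_reach_vars: "decidable 4 (\<lambda>e. reach (e 0) (e 1) (e 2) (e 3))"
  unfolding reach_def by (intro bound_rules decidable_table_trans) simp_all
lemmas decidable_reach = decidable_comp4[of reach, OF decidable_reach_vars]

lemma decidable_nstep_T_vars: "decidable 5 (\<lambda>e. nstep_T (e 0) (e 1) (e 2) (e 3) (e 4))"
  unfolding nstep_T_def by (intro bound_rules decidable_table_trans) simp_all
lemmas decidable_nstep_T = decidable_comp5[of nstep_T, OF decidable_nstep_T_vars]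

lemma decidable_nstep_D_vars: "decidable 5 (\<lambda>e. nstep_D (e 0) (e 1) (e 2) (e 3) (e 4))"
  unfolding nstep_D_def by (intro bound_rules decidable_table_trans decidable_reach) simp_all
lemmas decidable_nstep_D = decidable_comp5[of nstep_D, OF decidable_nstep_D_vars]

lemma decidable_nstep_cut_vars: "decidable 5 (\<lambda>e. nstep_cut (e 0) (e 1) (e 2) (e 3) (e 4))"
  unfolding nstep_cut_def by (intro bound_rules decidable_table_trans) simp_all
lemmas decidable_nstep_cut = decidable_comp5[of nstep_cut, OF decidable_nstep_cut_vars]

lemma decidable_nstep_vars: "decidable 5 (\<lambda>e. nstep (e 0) (e 1) (e 2) (e 3) (e 4))"
  unfolding nstep_def
    by (intro bound_rules decidable_nstep_T decidable_nstep_D decidable_nstep_cut) simp_all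
lemmas decidable_nstep = decidable_comp5[of nstep, OF decidable_nstep_vars]

lemma decidable_ninit_vars: "decidable 2 (\<lambda>e. ninit (e 0) (e 1))"
  unfolding ninit_def by (intro bound_rules decidable_reach) simp_all
lemmas decidable_ninit = decidable_comp2[of ninit, OF decidable_ninit_vars]

lemma decidable_pos_init_vars: "decidable 2 (\<lambda>e. pos_init (e 0) (e 1))"
  unfolding pos_init_def by (intro bound_rules decidable_ninit) simp_all
lemmas decidable_pos_init = decidable_comp2[of pos_init, OF decidable_pos_init_vars]

lemma decidable_pos_step_vars: "decidable 5 (\<lambda>e. pos_step (e 0) (e 1) (e 2) (e 3) (e 4))"
  unfolding pos_step_def by (intro bound_rules decidable_nstep) simp_all
lemmas decidable_pos_step = decidable_comp5[of pos_step, OF decidable_pos_step_vars]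

lemma decidable_pos_T_vars: "decidable 2 (\<lambda>e. pos_T (e 0) (e 1))"
  unfolding pos_T_def by (intro bound_rules) simp_all
lemmas decidable_pos_T = decidable_comp2[of pos_T, OF decidable_pos_T_vars]

lemma decidable_pos_S_vars: "decidable 2 (\<lambda>e. pos_S (e 0) (e 1))"
  unfolding pos_S_def by (intro bound_rules) simp_all
lemmas decidable_pos_S = decidable_comp2[of pos_S, OF decidable_pos_S_vars]

lemma decidable_pos_D_vars: "decidable 2 (\<lambda>e. pos_D (e 0) (e 1))"
  unfolding pos_D_def by (intro bound_rules) simp_all
lemmas decidable_pos_D = decidable_comp2[of pos_D, OF decidable_pos_D_vars]

lemma decidable_pos_useful_vars: "decidable 2 (\<lambda>e. pos_useful (e 0) (e 1))"
  unfolding pos_useful_def by (intro bound_rules decidable_reach) simp_all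
lemmas decidable_pos_useful = decidable_comp2[of pos_useful, OF decidable_pos_useful_vars]

lemma decidable_pos_reach_vars: "decidable 3 (\<lambda>e. pos_reach (e 0) (e 1) (e 2))"
  unfolding pos_reach_def by (intro bound_rules decidable_pos_step) simp_all
lemmas decidable_pos_reach = decidable_comp3[of pos_reach, OF decidable_pos_reach_vars]

lemma decidable_pos_good_vars: "decidable 3 (\<lambda>e. pos_good (e 0) (e 1) (e 2))"
  unfolding pos_good_def
  by (intro bound_rules decidable_pos_reach decidable_pos_D decidable_pos_T decidable_pos_S
      decidable_pos_step decidable_pos_useful) simp_all
lemmas decidable_pos_good = decidable_comp3[of pos_good, OF decidable_pos_good_vars]

lemma decidable_winning: "decidable 1 (\<lambda>e. winning (e 0))"
  unfolding winning_def by (intro bound_rules decidable_pos_init decidable_pos_good) simp_all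

lemma winning_recf: "\<exists>f. \<forall>v. eval f [v] (if winning v then 1 else 0)"
proof -
  obtain f where f: "\<And>e. eval f (map e [0..<1]) (if winning (e 0) then 1 else 0)"
    using decidable_winning by (auto simp: decidable_def computable_def)
  have "eval f [v] (if winning v then 1 else 0)" for v using f[of "\<lambda>_. v"] by simp
  then show ?thesis by blast
qed

section \<open>Sequential uniformizers and winning sets\<close>

lemma steps_append:
  "steps \<delta> q (u @ v) = (case steps \<delta> q u of None \<Rightarrow> None | Some p \<Rightarrow> steps \<delta> p v)"
  by (induction u arbitrary: q) (auto split: option.splits)

lemma steps_letters:
  assumes "dfa_wf k A" "steps (delta A) q w \<noteq> None"
  shows "w \<in> lists (Sigma_io k)"
  using assms(2)
proof (induction w arbitrary: q)
  case (Cons x w)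
  then obtain p where p: "delta A q x = Some p" "steps (delta A) p w \<noteq> None"
    by (auto split: option.splits)
  then have "x \<in> Sigma_io k" using assms(1) unfolding dfa_wf_def by blast
  then show ?case using Cons.IH[OF p(2)] by simp
qed simp

lemma proj_i_simps [simp]:
  "proj_i [] = []" "proj_i (x # w) = (if fst x = 1 then snd x # proj_i w else proj_i w)"
  "proj_i (u @ v) = proj_i u @ proj_i v"
  by (simp_all add: proj_i_def)

lemma proj_i_outputs [simp]: "x \<in> lists ({2} \<times> {..<k}) \<Longrightarrow> proj_i x = []"
  by (induction x) auto

lemma outputs_words: "x \<in> lists ({2} \<times> {..<k}) \<Longrightarrow> x \<in> lists (Sigma_io k)"
  by (induction x) (auto simp: Sigma_io_def)

lemma proj_i_Nil_outputs:
  "v \<in> lists (Sigma_io k) \<Longrightarrow> proj_i v = [] \<Longrightarrow> v \<in> lists ({2} \<times> {..<k})"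
  by (induction v) (auto simp: Sigma_io_def split: if_splits)

lemma proj_i_Cons_split:
  "v \<in> lists (Sigma_io k) \<Longrightarrow> proj_i v = a # u \<Longrightarrow>
     \<exists>x v'. v = x @ (1, a) # v' \<and> x \<in> lists ({2} \<times> {..<k})"
proof (induction v)
  case (Cons b v)
  show ?case
  proof (cases "fst b = 1")
    case True
    then show ?thesis using Cons.prems by (intro exI[of _ "[]"] exI[of _ v]) (cases b, auto)
  next
    case False
    then obtain x v' where "v = x @ (1, a) # v'" "x \<in> lists ({2} \<times> {..<k})" using Cons by auto
    moreover have "b \<in> {2} \<times> {..<k}" using False Cons.prems by (auto simp: Sigma_io_def)
    ultimately show ?thesis by (intro exI[of _ "b # x"] exI[of _ v']) auto
  qed
qed simp

text \<open>In a state of \<open>Qi\<close> both next letters are inputs and agree because one input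
  projection is a prefix of the other; in a state of \<open>Qo\<close> there is only one letter to
  choose. Hence the runs stay together until one of the words ends.\<close>

lemma sequential_runs_comparable:
  assumes A: "dfa_wf k A" "sequential A"
    and w: "steps (delta A) q w \<noteq> None" "steps (delta A) q w' \<noteq> None"
    and p: "prefix (proj_i w) (proj_i w')"
  shows "prefix w w' \<or> prefix w' w"
proof -
  obtain Qi Qo where Q: "Qi \<union> Qo = states A"
     "\<forall>q\<in>Qi. \<forall>x. delta A q x \<noteq> None \<longrightarrow> fst x = 1"
     "\<forall>q\<in>Qo. \<forall>x y. delta A q x \<noteq> None \<and> delta A q y \<noteq> None \<longrightarrow> x = y"
    using A(2) unfolding sequential_def by (elim exE conjE) (rule that)
  show ?thesis using w p
  proof (induction w arbitrary: q w')
    case (Cons x w)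
    show ?case
    proof (cases w')
      case c: (Cons x' v)
      obtain r r' where r: "delta A q x = Some r" "delta A q x' = Some r'"
        using Cons.prems c by (auto split: option.splits)
      then have "q \<in> states A" using A(1) unfolding dfa_wf_def by blast
      then have "q \<in> Qi \<or> q \<in> Qo" using Q(1) by blast
      then have x: "x = x'"
      proof
        assume "q \<in> Qi"
        then have "fst x = 1" "fst x' = 1" using Q(2) r by (metis option.distinct(1))+
        then show ?thesis using Cons.prems(3) c by (auto simp: prod_eq_iff)
      next
        assume "q \<in> Qo"
        then show ?thesis using Q(3) r by (metis option.distinct(1))
      qed
      have "prefix w v \<or> prefix v w"
        using Cons.IH[of r v] Cons.prems r c x by (auto split: if_splits)
      then show ?thesis using c x by auto
    qed simp
  qed simp
qed

text \<open>The strategy argument needs only that one of finitely many positions, computed letter by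
  letter, determines three facts about the word read: whether it may be accepted, whether its input
  lies in the domain, and whether its input can be extended to one in the domain.\<close>

locale sync_game =
  fixes k :: nat and LT :: "letter list set" and R :: "(nat list \<times> nat list) set"
    and p0 :: nat and stp :: "nat \<Rightarrow> letter \<Rightarrow> nat" and bd :: nat
    and acc inD use :: "nat \<Rightarrow> bool"
  assumes p0: "p0 < bd" and stp: "p < bd \<Longrightarrow> stp p x < bd"
    and acc: "w \<in> lists (Sigma_io k) \<Longrightarrow> acc (foldl stp p0 w) \<longleftrightarrow> w \<in> LT \<and> sem w \<in> R"
    and inD: "w \<in> lists (Sigma_io k) \<Longrightarrow> inD (foldl stp p0 w) \<longleftrightarrow> proj_i w \<in> Domain R"
    and use: "w \<in> lists (Sigma_io k) \<Longrightarrow> use (foldl stp p0 w) \<longleftrightarrow> (\<exists>u. proj_i w @ u \<in> Domain R)"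
    and dom: "u \<in> Domain R \<Longrightarrow> set u \<subseteq> {..<k}"
begin

text \<open>The output word is \<open>y @ z\<close>, with the accepting point after \<open>y\<close>.\<close>

definition good :: "nat set \<Rightarrow> nat \<Rightarrow> bool" where
  "good W p \<longleftrightarrow> (\<exists>y z. y \<in> lists ({2} \<times> {..<k}) \<and> z \<in> lists ({2} \<times> {..<k}) \<and>
     (inD p \<longrightarrow> acc (foldl stp p y)) \<and>
     (\<forall>a<k. use (stp (foldl stp p (y @ z)) (1, a)) \<longrightarrow> stp (foldl stp p (y @ z)) (1, a) \<in> W))"

lemma run_bound: "foldl stp p0 w < bd"
  by (induction w rule: rev_induct) (auto simp: p0 stp)

text \<open>The positions just after an input letter on runs of \<open>A\<close>, together with the
  initial one, form the winning set. Answers are copied from \<open>A\<close>: its outputs between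
  two inputs cannot depend on the next input letter.\<close>

lemma winning_set_of_uniformizer:
  assumes A: "dfa_wf k A" "sequential A" "lang A \<subseteq> LT" "uniformization (sem_set (lang A)) R"
  shows "\<exists>W\<subseteq>{..<bd}. p0 \<in> W \<and> (\<forall>p\<in>W. good W p)"
proof (intro exI conjI ballI)
  let ?runs = "\<lambda>w. steps (delta A) (init A) w \<noteq> None"
  let ?W = "{foldl stp p0 w | w. ?runs w \<and> (w = [] \<or> fst (last w) = 1)}"
  show "?W \<subseteq> {..<bd}" using run_bound by blast
  show "p0 \<in> ?W" by (intro CollectI exI[of _ "[]"]) simp
  have runs_prefix: "?runs u" if "?runs (u @ v)" for u v
    using that by (auto simp: steps_append split: option.splits)
  fix p assume "p \<in> ?W"
  then obtain w where w: "p = foldl stp p0 w" "?runs w" "w = [] \<or> fst (last w) = 1" by auto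
  have ww: "w \<in> lists (Sigma_io k)" using steps_letters[OF A(1) w(2)] .
  \<comment> \<open>Since \<open>w\<close> is empty or ends with an input, the accepted word for the
    input \<open>proj_i w @ u'\<close> cannot stop inside \<open>w\<close>; so it extends
    \<open>w\<close>.\<close>
  have ext: "\<exists>v. w @ v \<in> lang A \<and> proj_i v = u' \<and> v \<in> lists (Sigma_io k)"
    if D: "proj_i w @ u' \<in> Domain R" for u'
  proof -
    have "proj_i w @ u' \<in> Domain (sem_set (lang A))" using A(4) D by (simp add: uniformization_def)
    then obtain w' where w': "w' \<in> lang A" "proj_i w' = proj_i w @ u'"
      by (auto simp: sem_set_def sem_def)
    then have r': "?runs w'" by (auto simp: lang_def)
    have "prefix w w' \<or> prefix w' w"
      using sequential_runs_comparable[OF A(1,2) w(2) r'] w'(2) by simp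
    then have "prefix w w'"
    proof
      assume "prefix w' w"
      then obtain z where z: "w = w' @ z" by (auto elim: prefixE)
      then have "proj_i z = []" using w'(2) by simp
      then have "z = []" using w(3) z by (cases z rule: rev_cases) auto
      then show ?thesis using z by simp
    qed
    then obtain v where v: "w' = w @ v" by (auto elim: prefixE)
    then have "v \<in> lists (Sigma_io k)" using steps_letters[OF A(1) r'] by simp
    then show ?thesis using v w' by auto
  qed
  \<comment> \<open>Output states offer one letter, so the outputs possible after \<open>w\<close>
    form a chain, whose longest member is the one where an input can follow.\<close>
  have pre: "prefix y x" if "?runs (w @ x @ [(1, a)])" "?runs (w @ y)"
    "x \<in> lists ({2} \<times> {..<k})" "y \<in> lists ({2} \<times> {..<k})" for x y a
  proof -
    have "prefix (w @ y) (w @ x @ [(1, a)]) \<or> prefix (w @ x @ [(1, a)]) (w @ y)"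
      using that by (intro sequential_runs_comparable[OF A(1,2)]) auto
    moreover have "\<not> prefix (w @ x @ [(1, a)]) (w @ y)"
      using that(4) by (auto simp: prefix_def)
    ultimately have "prefix y (x @ [(1, a)])" by simp
    then show ?thesis using that(4) by (auto simp: prefix_snoc)
  qed
  have fol: "\<exists>x. x \<in> lists ({2} \<times> {..<k}) \<and> ?runs (w @ x @ [(1, a)])"
    if D: "proj_i w @ a # u' \<in> Domain R" for a u'
  proof -
    obtain v where v: "w @ v \<in> lang A" "proj_i v = a # u'" "v \<in> lists (Sigma_io k)"
      using ext[OF D] by blast
    then obtain x v' where x: "v = x @ (1, a) # v'" "x \<in> lists ({2} \<times> {..<k})"
      using proj_i_Cons_split[OF v(3,2)] by blast
    have "?runs ((w @ x @ [(1, a)]) @ v')" using v(1) x by (auto simp: lang_def)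
    then show ?thesis using x(2) runs_prefix by blast
  qed
  have ac: "\<exists>y. y \<in> lists ({2} \<times> {..<k}) \<and> ?runs (w @ y) \<and> (inD p \<longrightarrow> acc (foldl stp p y))"
  proof (cases "inD p")
    case True
    then have "proj_i w @ [] \<in> Domain R" using inD[OF ww] w(1) by simp
    then obtain y where y: "w @ y \<in> lang A" "proj_i y = []" "y \<in> lists (Sigma_io k)" using ext by blast
    have "sem (w @ y) \<in> R" using A(4) y(1) by (auto simp: uniformization_def sem_set_def)
    then have "acc (foldl stp p y)" using acc[of "w @ y"] ww y A(3) w(1) by auto
    moreover have "?runs (w @ y)" using y(1) by (auto simp: lang_def)
    ultimately show ?thesis using proj_i_Nil_outputs[OF y(3,2)] by blast
  qed (use w(2) in \<open>intro exI[of _ "[]"], simp\<close>)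
  then obtain y where y: "y \<in> lists ({2} \<times> {..<k})" "?runs (w @ y)" "inD p \<longrightarrow> acc (foldl stp p y)"
    by blast
  have use_iff: "use (stp (foldl stp p x) (1, a)) \<longleftrightarrow> (\<exists>u'. proj_i w @ a # u' \<in> Domain R)"
    if "a < k" "x \<in> lists ({2} \<times> {..<k})" for a x
    using use[of "w @ x @ [(1, a)]"] ww that outputs_words[OF that(2)] w(1)
    by (auto simp: Sigma_io_def)
  show "good ?W p"
  proof (cases "\<exists>a<k. \<exists>u'. proj_i w @ a # u' \<in> Domain R")
    case True
    \<comment> \<open>One continuation in the domain fixes the full answer \<open>x\<close>; by
      \<open>pre\<close> the outputs before any other useful input letter are the same.\<close>
    then obtain a0 u0 where "proj_i w @ a0 # u0 \<in> Domain R" by blast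
    then obtain x where x: "x \<in> lists ({2} \<times> {..<k})" "?runs (w @ x @ [(1, a0)])" using fol by blast
    have "prefix y x" using pre[OF x(2) y(2) x(1) y(1)] .
    then obtain z where z: "x = y @ z" by (auto elim: prefixE)
    have "stp (foldl stp p x) (1, a) \<in> ?W" if a: "a < k" "use (stp (foldl stp p x) (1, a))" for a
    proof -
      obtain x' where x': "x' \<in> lists ({2} \<times> {..<k})" "?runs (w @ x' @ [(1, a)])"
        using fol use_iff[OF a(1) x(1)] a(2) by blast
      have "?runs (w @ x)" "?runs (w @ x')"
        using x(2) x'(2) runs_prefix[of "w @ x"] runs_prefix[of "w @ x'"] by auto
      then have "x = x'" using pre[OF x(2) _ x(1) x'(1)] pre[OF x'(2) _ x'(1) x(1)]
        by (meson prefix_order.antisym)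
      then show ?thesis using x'(2) w(1) by (intro CollectI exI[of _ "w @ x @ [(1, a)]"]) simp
    qed
    then show ?thesis unfolding good_def using x(1) y z by (intro exI[of _ y] exI[of _ z]) auto
  next
    case False
    then show ?thesis unfolding good_def using y use_iff by (intro exI[of _ y] exI[of _ "[]"]) auto
  qed
qed

text \<open>Each answer has at most one accepting state, after \<open>Y p\<close>; the remainder
  \<open>V p\<close> only leads on to the next input. This makes the relation functional although
  the automaton may write on after accepting.\<close>

lemma uniformizer_of_winning_set:
  assumes W: "W \<subseteq> {..<bd}" "p0 \<in> W" "\<forall>p\<in>W. good W p"
  shows "\<exists>A. dfa_wf k A \<and> sequential A \<and> lang A \<subseteq> LT \<and> uniformization (sem_set (lang A)) R"
proof -
  obtain Y V where YV: "\<And>p. p \<in> W \<Longrightarrow> Y p \<in> lists ({2} \<times> {..<k}) \<and> V p \<in> lists ({2} \<times> {..<k}) \<and>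
     (inD p \<longrightarrow> acc (foldl stp p (Y p))) \<and>
     (\<forall>a<k. use (stp (foldl stp p (Y p @ V p)) (1, a)) \<longrightarrow> stp (foldl stp p (Y p @ V p)) (1, a) \<in> W)"
    using W(3) unfolding good_def by metis
  define X where "X p = Y p @ V p" for p
  define out where "out p = foldl stp p (X p)" for p
  have X: "X p \<in> lists ({2} \<times> {..<k})" if "p \<in> W" for p using YV[OF that] by (simp add: X_def)
  have out: "stp (out p) (1, a) \<in> W" if "p \<in> W" "a < k" "use (stp (out p) (1, a))" for p a
    using YV[OF that(1)] that by (simp add: X_def out_def)
  have YX: "Y p = take (length (Y p)) (X p)" "length (Y p) \<le> length (X p)" for p
    by (simp_all add: X_def)
  \<comment> \<open>The state \<open>(p, j)\<close> has arrived at \<open>p\<close> and written \<open>j\<close> letters of the answer \<open>X p\<close>.\<close>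
  define \<delta> where "\<delta> s x = (case prod_decode s of (p, j) \<Rightarrow>
      if p \<in> W \<and> j < length (X p) then (if x = X p ! j then Some (prod_encode (p, Suc j)) else None)
      else if p \<in> W \<and> j = length (X p) \<and> fst x = 1 \<and> snd x < k \<and> use (stp (out p) x)
      then Some (prod_encode (stp (out p) x, 0)) else None)" for s x
  define A :: dfa where "A = (prod_encode ` (SIGMA p:W. {..length (X p)}), prod_encode (p0, 0), \<delta>,
      {prod_encode (p, length (Y p)) | p. p \<in> W \<and> inD p})"
  have A_simps: "states A = prod_encode ` (SIGMA p:W. {..length (X p)})" "init A = prod_encode (p0, 0)"
    "delta A = \<delta>" "finals A = {prod_encode (p, length (Y p)) | p. p \<in> W \<and> inD p}"
    by (simp_all add: A_def)
  have \<delta>_Some: "\<delta> s x = Some s' \<Longrightarrow> \<exists>p j. s = prod_encode (p, j) \<and> p \<in> W \<and>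
     (j < length (X p) \<and> x = X p ! j \<and> s' = prod_encode (p, Suc j) \<or>
      j = length (X p) \<and> x = (1, snd x) \<and> snd x < k \<and> use (stp (out p) x) \<and>
        s' = prod_encode (stp (out p) x, 0))" for s x s'
  proof -
    assume a: "\<delta> s x = Some s'"
    obtain p j where pj: "prod_decode s = (p, j)" by force
    then have "s = prod_encode (p, j)" by (metis prod_decode_inverse)
    then show ?thesis using a pj by (cases x) (auto simp: \<delta>_def split: if_splits)
  qed
  have letter: "X p ! j \<in> {2} \<times> {..<k}" if "p \<in> W" "j < length (X p)" for p j
    using X[OF that(1)] that(2) by (metis in_listsD nth_mem)
  have wf: "dfa_wf k A"
  proof -
    have "finite W" using W(1) finite_subset by blast
    then have "finite (states A)" by (simp add: A_simps)
    moreover have "init A \<in> states A" using W(2) by (auto simp: A_simps)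
    moreover have "finals A \<subseteq> states A" using YX(2) by (auto simp: A_simps)
    moreover have "q \<in> states A \<and> x \<in> Sigma_io k \<and> q' \<in> states A" if qx: "delta A q x = Some q'" for q x q'
    proof -
      obtain p j where pj: "q = prod_encode (p, j)" "p \<in> W"
         "j < length (X p) \<and> x = X p ! j \<and> q' = prod_encode (p, Suc j) \<or>
          j = length (X p) \<and> x = (1, snd x) \<and> snd x < k \<and> use (stp (out p) x) \<and>
          q' = prod_encode (stp (out p) x, 0)"
        using \<delta>_Some[OF qx[unfolded A_simps]] by blast
      from pj(3) show ?thesis
      proof (elim disjE conjE)
        assume "j < length (X p)" "x = X p ! j" "q' = prod_encode (p, Suc j)"
        then show ?thesis using pj(1,2) letter[of p j] by (auto simp: A_simps Sigma_io_def)
      next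
        assume a: "j = length (X p)" "x = (1, snd x)" "snd x < k" "use (stp (out p) x)"
          "q' = prod_encode (stp (out p) x, 0)"
        then have "stp (out p) x \<in> W" using out[OF pj(2) a(3)] by metis
        moreover have "x \<in> Sigma_io k" using a(2,3) by (cases x) (simp add: Sigma_io_def)
        ultimately show ?thesis using a pj(1,2) by (auto simp: A_simps)
      qed
    qed
    ultimately show ?thesis unfolding dfa_wf_def by blast
  qed
  have seq: "sequential A"
    unfolding sequential_def
  proof (intro exI conjI ballI allI impI)
    let ?Qi = "prod_encode ` (SIGMA p:W. {length (X p)})"
    let ?Qo = "prod_encode ` (SIGMA p:W. {..<length (X p)})"
    show "?Qi \<union> ?Qo = states A" by (force simp: A_simps)
    show "?Qi \<inter> ?Qo = {}" by auto
    show "fst x = 1" if "q \<in> ?Qi" "delta A q x \<noteq> None" for q x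
      using that by (auto simp: A_simps \<delta>_def split: if_splits)
    show "fst x = 2" if "q \<in> ?Qo" "delta A q x \<noteq> None" for q x
      using that letter by (fastforce simp: A_simps \<delta>_def split: if_splits)
    show "x = y" if "q \<in> ?Qo" "delta A q x \<noteq> None \<and> delta A q y \<noteq> None" for q x y
      using that by (auto simp: A_simps \<delta>_def split: if_splits)
  qed
  \<comment> \<open>\<open>w0\<close> is the part of the word that had been read when the position
    \<open>p\<close> was entered; this ties the states of \<open>A\<close> to positions, about which
    \<open>acc\<close> speaks.\<close>
  have inv: "\<exists>p j w0. s = prod_encode (p, j) \<and> p \<in> W \<and> j \<le> length (X p) \<and> w = w0 @ take j (X p) \<and>
      foldl stp p0 w0 = p" if "steps \<delta> (prod_encode (p0, 0)) w = Some s" for w s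
    using that
  proof (induction w arbitrary: s rule: rev_induct)
    case Nil
    then show ?case using W(2) by auto
  next
    case (snoc x w)
    then obtain r where r: "steps \<delta> (prod_encode (p0, 0)) w = Some r" "\<delta> r x = Some s"
      by (auto simp: steps_append split: option.splits)
    obtain p j w0 where 1: "r = prod_encode (p, j)" "p \<in> W" "j \<le> length (X p)"
      "w = w0 @ take j (X p)" "foldl stp p0 w0 = p" using snoc.IH[OF r(1)] by blast
    from \<delta>_Some[OF r(2)] 1(1)
    have "j < length (X p) \<and> x = X p ! j \<and> s = prod_encode (p, Suc j) \<or>
      j = length (X p) \<and> x = (1, snd x) \<and> snd x < k \<and> use (stp (out p) x) \<and>
        s = prod_encode (stp (out p) x, 0)" by auto
    then show ?case
    proof (elim disjE conjE)
      assume "j < length (X p)" "x = X p ! j" "s = prod_encode (p, Suc j)"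
      then show ?thesis using 1
        by (intro exI[of _ p] exI[of _ "Suc j"] exI[of _ w0]) (simp add: take_Suc_conv_app_nth)
    next
      assume a: "j = length (X p)" "x = (1, snd x)" "snd x < k" "use (stp (out p) x)"
        "s = prod_encode (stp (out p) x, 0)"
      then have "stp (out p) x \<in> W" using out[OF 1(2) a(3)] by metis
      then show ?thesis using 1 a
        by (intro exI[of _ "stp (out p) x"] exI[of _ 0] exI[of _ "w @ [x]"]) (simp add: out_def)
    qed
  qed
  have accepted: "w \<in> LT \<and> sem w \<in> R" if w: "w \<in> lang A" for w
  proof -
    obtain s p where s: "steps \<delta> (prod_encode (p0, 0)) w = Some s" "s = prod_encode (p, length (Y p))"
      "p \<in> W" "inD p"
      using w by (auto simp: lang_def A_simps)
    then obtain w0 where "w = w0 @ take (length (Y p)) (X p)" "foldl stp p0 w0 = p"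
      using inv[OF s(1)] by auto
    then have "acc (foldl stp p0 w)" using YV[OF s(3)] s(4) YX(1)[of p] by simp
    moreover have "w \<in> lists (Sigma_io k)"
      using steps_letters[OF wf, of "init A" w] s(1) by (simp add: A_simps)
    ultimately show ?thesis using acc by blast
  qed
  have steps_take: "steps \<delta> (prod_encode (p, 0)) (take j (X p)) = Some (prod_encode (p, j))"
    if "p \<in> W" "j \<le> length (X p)" for p j using that(2)
  proof (induction j)
    case (Suc j)
    then show ?case using that(1) by (simp add: take_Suc_conv_app_nth steps_append \<delta>_def)
  qed simp
  \<comment> \<open>The remainder \<open>u2\<close> keeps the claim inductive: prefixes of a domain
    element need not lie in the domain, but they pass the \<open>use\<close> test of the
    transition.\<close>
  have total: "\<exists>w. proj_i w = u1 \<and> w \<in> lists (Sigma_io k) \<and> foldl stp p0 w \<in> W \<and>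
      steps \<delta> (prod_encode (p0, 0)) w = Some (prod_encode (foldl stp p0 w, 0))"
    if "u1 @ u2 \<in> Domain R" for u1 u2
    using that
  proof (induction u1 arbitrary: u2 rule: rev_induct)
    case Nil
    show ?case by (rule exI[of _ "[]"]) (simp add: W(2))
  next
    case (snoc a u1)
    obtain w where w: "proj_i w = u1" "w \<in> lists (Sigma_io k)" "foldl stp p0 w \<in> W"
      "steps \<delta> (prod_encode (p0, 0)) w = Some (prod_encode (foldl stp p0 w, 0))"
      using snoc.IH[of "a # u2"] snoc.prems by auto
    define p where "p = foldl stp p0 w"
    have a: "a < k" using dom[OF snoc.prems] by auto
    let ?w = "w @ X p @ [(1, a)]"
    have ww: "?w \<in> lists (Sigma_io k)"
      using w(2) outputs_words[OF X] w(3) a by (auto simp: p_def Sigma_io_def)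
    have pi: "proj_i ?w = u1 @ [a]" using w(1) proj_i_outputs[OF X[OF w(3)]] by (simp add: p_def)
    have "use (foldl stp p0 ?w)" unfolding use[OF ww] pi using snoc.prems by blast
    then have u: "use (stp (out p) (1, a))" by (simp add: p_def out_def)
    have st: "steps \<delta> (prod_encode (p, 0)) (X p) = Some (prod_encode (p, length (X p)))"
      using steps_take[of p "length (X p)"] w(3) by (simp add: p_def)
    have "steps \<delta> (prod_encode (p0, 0)) ?w = Some (prod_encode (foldl stp p0 ?w, 0))"
      using w(3,4) st u a by (simp add: steps_append p_def[symmetric] \<delta>_def out_def)
    moreover have "foldl stp p0 ?w \<in> W" using out[OF _ a u] w(3) by (simp add: p_def out_def)
    ultimately show ?case using pi ww by blast
  qed
  have dom_eq: "Domain (sem_set (lang A)) = Domain R"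
  proof
    show "Domain (sem_set (lang A)) \<subseteq> Domain R"
      using accepted by (intro Domain_mono) (auto simp: sem_set_def)
    show "Domain R \<subseteq> Domain (sem_set (lang A))"
    proof
      fix u assume u: "u \<in> Domain R"
      then obtain w where w: "proj_i w = u" "w \<in> lists (Sigma_io k)" "foldl stp p0 w \<in> W"
        "steps \<delta> (prod_encode (p0, 0)) w = Some (prod_encode (foldl stp p0 w, 0))"
        using total[of u "[]"] by auto
      define p where "p = foldl stp p0 w"
      have "steps \<delta> (prod_encode (p0, 0)) (w @ Y p) = Some (prod_encode (p, length (Y p)))"
        using w(3,4) steps_take[of p "length (Y p)"] YX[of p] by (simp add: steps_append p_def)
      moreover have "inD p" using inD[OF w(2)] w(1) u by (simp add: p_def)
      ultimately have "w @ Y p \<in> lang A" using w(3) by (auto simp: lang_def A_simps p_def)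
      moreover have "proj_i (w @ Y p) = u"
        using proj_i_outputs[of "Y p" k] YV[OF w(3)] w(1) by (simp add: p_def)
      ultimately have "(u, proj_o (w @ Y p)) \<in> sem_set (lang A)"
        unfolding sem_set_def by (metis imageI sem_def)
      then show "u \<in> Domain (sem_set (lang A))" by blast
    qed
  qed
  \<comment> \<open>Without inputs the position \<open>p\<close> cannot change and the index only
    grows, so a second accepting point would need the index \<open>length (Y p)\<close>
    again.\<close>
  have along: "steps \<delta> (prod_encode (p, j)) z = Some s \<Longrightarrow> p \<in> W \<Longrightarrow> proj_i z = [] \<Longrightarrow>
      s = prod_encode (p, j + length z)" for p j z s
  proof (induction z arbitrary: j)
    case (Cons x z)
    then obtain r where r: "\<delta> (prod_encode (p, j)) x = Some r" "steps \<delta> r z = Some s"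
      by (auto split: option.splits)
    have "fst x \<noteq> 1" "proj_i z = []" using Cons.prems(3) by (auto split: if_splits)
    then show ?case using Cons.IH[of "Suc j"] \<delta>_Some[OF r(1)] r(2) Cons.prems(2)
      by (cases x) auto
  qed simp
  have unique: "w' = w" if h: "w \<in> lang A" "w' \<in> lang A" "proj_i w = proj_i w'" "prefix w w'" for w w'
  proof -
    obtain z where z: "w' = w @ z" using h(4) by (auto elim: prefixE)
    obtain p where p: "steps \<delta> (prod_encode (p0, 0)) w = Some (prod_encode (p, length (Y p)))" "p \<in> W"
      using h(1) by (auto simp: lang_def A_simps)
    obtain p' where p': "steps \<delta> (prod_encode (p0, 0)) w' = Some (prod_encode (p', length (Y p')))"
      using h(2) by (auto simp: lang_def A_simps)
    have "steps \<delta> (prod_encode (p, length (Y p))) z = Some (prod_encode (p', length (Y p')))"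
      using p p' z by (simp add: steps_append)
    then have "prod_encode (p', length (Y p')) = prod_encode (p, length (Y p) + length z)"
      using along[OF _ p(2)] h(3) z by simp
    then show ?thesis using z by auto
  qed
  have "single_valued (sem_set (lang A))"
  proof (rule single_valuedI)
    fix u v v' assume "(u, v) \<in> sem_set (lang A)" "(u, v') \<in> sem_set (lang A)"
    then obtain w w' where w: "w \<in> lang A" "w' \<in> lang A" "sem w = (u, v)" "sem w' = (u, v')"
      by (auto simp: sem_set_def)
    then have pi: "proj_i w = proj_i w'" by (simp add: sem_def)
    have "prefix w w' \<or> prefix w' w"
      using w(1,2) pi by (intro sequential_runs_comparable[OF wf seq, of "init A"]) (auto simp: lang_def)
    then have "w = w'" using unique[OF w(1,2) pi] unique[OF w(2,1) pi[symmetric]] by auto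
    then show "v = v'" using w by simp
  qed
  then have "uniformization (sem_set (lang A)) R"
    using dom_eq accepted by (auto simp: uniformization_def sem_set_def)
  then show ?thesis using wf seq accepted by blast
qed

lemma uniformizer_iff_winning_set:
  "(\<exists>A. dfa_wf k A \<and> sequential A \<and> lang A \<subseteq> LT \<and> uniformization (sem_set (lang A)) R) \<longleftrightarrow>
   (\<exists>W\<subseteq>{..<bd}. p0 \<in> W \<and> (\<forall>p\<in>W. good W p))"
  using winning_set_of_uniformizer uniformizer_of_winning_set by blast

end

section \<open>Finite shift and cut states\<close>

lemma steps_lt:
  assumes "\<And>q x p. \<delta> q x = Some p \<Longrightarrow> p < n" "q < n" "steps \<delta> q w = Some p"
  shows "p < n"
  using assms(2,3)
proof (induction w arbitrary: q)
  case (Cons x w)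
  then obtain r where "\<delta> q x = Some r" "steps \<delta> r w = Some p" by (auto split: option.splits)
  then show ?case using Cons.IH[of r] assms(1) by blast
qed simp

text \<open>Only an inequality, as the seam may contribute one more shift.\<close>

lemma shift_append: "shift u + shift v \<le> shift (u @ v)"
proof -
  let ?J = "\<lambda>w. {j. Suc j < length w \<and> fst (w ! j) \<noteq> fst (w ! Suc j)}"
  have fin: "finite (?J w)" for w :: "letter list" by (rule finite_subset[of _ "{..<length w}"]) auto
  have "?J u \<union> (+) (length u) ` ?J v \<subseteq> ?J (u @ v)" by (auto simp: nth_append)
  then have "card (?J u \<union> (+) (length u) ` ?J v) \<le> shift (u @ v)"
    unfolding shift_def by (rule card_mono[OF fin])
  moreover have "card (?J u \<union> (+) (length u) ` ?J v) = card (?J u) + card ((+) (length u) ` ?J v)"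
    by (rule card_Un_disjoint) (use fin in auto)
  moreover have "card ((+) (length u) ` ?J v) = card (?J v)" by (intro card_image) (simp add: inj_on_def)
  ultimately show ?thesis by (simp add: shift_def)
qed

lemma shift_snoc:
  assumes "w \<noteq> []" "fst (last w) \<noteq> fst x" shows "shift w + 1 \<le> shift (w @ [x])"
proof -
  let ?J = "\<lambda>w. {j. Suc j < length w \<and> fst (w ! j) \<noteq> fst (w ! Suc j)}"
  have fin: "finite (?J w)" for w :: "letter list" by (rule finite_subset[of _ "{..<length w}"]) auto
  have "insert (length w - 1) (?J w) \<subseteq> ?J (w @ [x])"
    using assms by (auto simp: nth_append last_conv_nth)
  then have "card (insert (length w - 1) (?J w)) \<le> shift (w @ [x])"
    unfolding shift_def by (rule card_mono[OF fin])
  moreover have "length w - 1 \<notin> ?J w" by auto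
  ultimately show ?thesis using fin[of w] by (simp add: shift_def)
qed

lemma shift_concat_replicate: "i * shift d \<le> shift (concat (replicate i d))"
proof (induction i)
  case (Suc i)
  then show ?case using shift_append[of d "concat (replicate i d)"] by simp
qed simp

lemma steps_concat_replicate:
  "steps \<delta> p d = Some p \<Longrightarrow> steps \<delta> p (concat (replicate i d)) = Some p"
  by (induction i) (simp_all add: steps_append)

lemma shift_bound:
  assumes A: "dfa_wf k A" and fs: "finite_shift (lang A)" and z: "z \<in> lang A"
  shows "shift z \<le> 2 * card (states A)"
proof -
  define J where "J = {j. Suc j < length z \<and> fst (z ! j) \<noteq> fst (z ! Suc j)}"
  \<comment> \<open>The state between the letters \<open>j\<close> and \<open>j + 1\<close>, that
    is, at the moment of the shift.\<close>
  define st where "st j = the (steps (delta A) (init A) (take (Suc j) z))" for j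
  have finJ: "finite J" unfolding J_def by (rule finite_subset[of _ "{..<length z}"]) auto
  obtain f where f: "steps (delta A) (init A) z = Some f" "f \<in> finals A" using z by (auto simp: lang_def)
  have "steps (delta A) (init A) (take j z @ drop j z) = Some f" for j using f(1) by simp
  then have pre: "\<exists>p. steps (delta A) (init A) (take j z) = Some p \<and> steps (delta A) p (drop j z) = Some f" for j
    unfolding steps_append
      by (cases "steps (delta A) (init A) (take j z)") (metis option.simps(3,4), metis option.simps(5))
  have in_states: "steps (delta A) q w = Some p \<Longrightarrow> q \<in> states A \<Longrightarrow> p \<in> states A" for q w p
  proof (induction w arbitrary: q)
    case (Cons x w)
    then obtain r where r: "delta A q x = Some r" "steps (delta A) r w = Some p"
      by (auto split: option.splits)
    then have "r \<in> states A" using A unfolding dfa_wf_def by blast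
    then show ?case using Cons.IH[OF r(2)] by blast
  qed simp
  have st: "st j \<in> states A" for j
  proof -
    obtain p where p: "steps (delta A) (init A) (take (Suc j) z) = Some p" using pre by blast
    moreover have "init A \<in> states A" using A by (simp add: dfa_wf_def)
    ultimately show ?thesis using in_states[OF p] by (simp add: st_def)
  qed
  \<comment> \<open>Of three shifts at the same state, the middle one lies inside the loop between the outer two.\<close>
  have fibre: "card {j \<in> J. st j = q} \<le> 2" for q
  proof (rule ccontr)
    define C where "C = {j \<in> J. st j = q}"
    assume "\<not> card {j \<in> J. st j = q} \<le> 2"
    then have c3: "card C > 2" by (simp add: C_def)
    have finC: "finite C" using finJ by (simp add: C_def)
    have ne: "C \<noteq> {}" using c3 by auto
    define a where "a = Min C"
    define c where "c = Max C"
    have "card (C - {a, c}) \<ge> card C - card {a, c}" by (rule diff_card_le_card_Diff) simp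
    moreover have "card {a, c} \<le> 2" by (simp add: card_insert_if)
    ultimately have "card (C - {a, c}) > 0" using c3 by simp
    then obtain b where b: "b \<in> C" "b \<noteq> a" "b \<noteq> c"
      by (metis Diff_iff all_not_in_conv card.empty insertCI less_irrefl)
    have "a \<le> b" "b \<le> c" unfolding a_def c_def using Min_le[OF finC b(1)] Max_ge[OF finC b(1)] .
    then have abc: "a < b" "b < c" using b by auto
    have ac: "a \<in> C" "c \<in> C" unfolding a_def c_def using Min_in[OF finC ne] Max_in[OF finC ne] .
    \<comment> \<open>The loop consists of the letters \<open>a + 1\<close> to \<open>c\<close> and
      so contains both letters of the shift at \<open>b\<close>.\<close>
    define d where "d = take (c - a) (drop (Suc a) z)"
    have cz: "Suc c < length z" using ac by (simp add: C_def J_def)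
    have ld: "length d = c - a" using cz abc by (simp add: d_def)
    have zd: "take (Suc a) z @ d = take (Suc c) z"
      using abc take_add[of "Suc a" "c - a" z] by (simp add: d_def)
    have sa: "steps (delta A) (init A) (take (Suc a) z) = Some q"
      and sc: "steps (delta A) (init A) (take (Suc c) z) = Some q"
      using pre[of "Suc a"] pre[of "Suc c"] ac by (auto simp: C_def st_def)
    have "steps (delta A) q (drop (Suc c) z) = Some f" using pre[of "Suc c"] sc by auto
    moreover have dd: "steps (delta A) q d = Some q" using sa sc unfolding zd[symmetric] steps_append by simp
    ultimately have "take (Suc a) z @ concat (replicate i d) @ drop (Suc c) z \<in> lang A" for i
      using sa f(2) steps_concat_replicate[OF dd] by (simp add: lang_def steps_append)
    moreover have "i * shift d \<le> shift (take (Suc a) z @ concat (replicate i d) @ drop (Suc c) z)" for i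
      using shift_append[of "take (Suc a) z" "concat (replicate i d) @ drop (Suc c) z"]
        shift_append[of "concat (replicate i d)" "drop (Suc c) z"] shift_concat_replicate[of i d] by linarith
    moreover have "shift d \<ge> 1"
    proof -
      have "d ! (b - Suc a) = z ! b" "d ! Suc (b - Suc a) = z ! Suc b"
        using abc cz by (simp_all add: d_def)
      then have "b - Suc a \<in> {j. Suc j < length d \<and> fst (d ! j) \<noteq> fst (d ! Suc j)}"
        using b(1) abc ld by (simp add: C_def J_def)
      moreover have "finite {j. Suc j < length d \<and> fst (d ! j) \<noteq> fst (d ! Suc j)}"
        by (rule finite_subset[of _ "{..<length d}"]) auto
      ultimately have "shift d \<noteq> 0" unfolding shift_def by (metis card_0_eq empty_iff)
      then show ?thesis by simp
    qed
    moreover obtain N where "\<forall>w\<in>lang A. shift w \<le> N" using fs by (auto simp: finite_shift_def)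
    \<comment> \<open>\<open>Suc N\<close> copies of a loop with at least one shift exceed the bound
      \<open>N\<close>.\<close>
    ultimately have "Suc N * shift d \<le> N" by (meson order_trans)
    then show False using \<open>shift d \<ge> 1\<close> by (cases "shift d") auto
  qed
  have fin: "finite (states A)" using A by (simp add: dfa_wf_def)
  have "J = (\<Union>q\<in>states A. {j \<in> J. st j = q})" using st by auto
  then have "card J \<le> (\<Sum>q\<in>states A. card {j \<in> J. st j = q})"
    using card_UN_le[OF fin, of "\<lambda>q. {j \<in> J. st j = q}"] by simp
  also have "\<dots> \<le> (\<Sum>q\<in>states A. 2)" by (intro sum_mono fibre)
  finally show ?thesis by (simp add: J_def shift_def)
qed

text \<open>The semantic counterpart of the nodes of kind 2: the letters of \<open>w\<close> in the direction of block \<open>l\<close>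
  are parsed into the blocks \<open>l mod 2\<close>, \<open>l mod 2 + 2\<close>, ..., \<open>l\<close>, the last of which has reached \<open>q\<close>.\<close>

inductive track :: "(nat \<Rightarrow> letter \<Rightarrow> nat option) \<Rightarrow> (nat \<Rightarrow> nat) \<Rightarrow> letter list \<Rightarrow> nat \<Rightarrow> nat \<Rightarrow> bool"
  for \<delta> s where
  track_Nil: "l < 2 \<Longrightarrow> track \<delta> s [] l (s l)"
| track_skip: "track \<delta> s w l q \<Longrightarrow> fst x \<noteq> Suc (l mod 2) \<Longrightarrow> track \<delta> s (w @ [x]) l q"
| track_stay: "track \<delta> s w l q \<Longrightarrow> fst x = Suc (l mod 2) \<Longrightarrow> \<delta> q x = Some q' \<Longrightarrow> track \<delta> s (w @ [x]) l q'"
| track_next: "track \<delta> s w l (s (l + 1)) \<Longrightarrow> fst x = Suc (l mod 2) \<Longrightarrow> \<delta> (s (l + 2)) x = Some q' \<Longrightarrow>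
    track \<delta> s (w @ [x]) (l + 2) q'"

lemma track_Nil_iff: "track \<delta> s [] l q \<longleftrightarrow> l < 2 \<and> q = s l"
  by (auto elim: track.cases intro: track_Nil)

lemma track_snoc_iff: "track \<delta> s (w @ [x]) l q \<longleftrightarrow>
    fst x \<noteq> Suc (l mod 2) \<and> track \<delta> s w l q \<or>
    fst x = Suc (l mod 2) \<and> (\<exists>p. track \<delta> s w l p \<and> \<delta> p x = Some q) \<or>
    fst x = Suc (l mod 2) \<and> (\<exists>l'. l = l' + 2 \<and> track \<delta> s w l' (s (l' + 1)) \<and> \<delta> (s (l' + 2)) x = Some q)"
  (is "?L \<longleftrightarrow> ?R")
proof
  show ?R if ?L using that by (cases rule: track.cases) auto
  show ?L if ?R using that
    by (auto intro: track_skip track_stay track_next[unfolded add_2_eq_Suc' Suc_eq_plus1[symmetric]])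
qed

section \<open>Parsing the two directions independently\<close>

definition proj_dir :: "nat \<Rightarrow> letter list \<Rightarrow> nat list" where
  "proj_dir d w = map snd (filter (\<lambda>x. fst x = d) w)"

lemma proj_dir_simps [simp]: "proj_dir d [] = []" "proj_dir d (u @ v) = proj_dir d u @ proj_dir d v"
  "proj_dir d [x] = (if fst x = d then [snd x] else [])"
  by (simp_all add: proj_dir_def)

lemma proj_i_eq: "proj_i w = proj_dir 1 w" and proj_o_eq: "proj_o w = proj_dir 2 w"
  by (simp_all add: proj_i_def proj_o_def proj_dir_def)

lemma proj_dir_other: "set w \<subseteq> {d} \<times> UNIV \<Longrightarrow> d \<noteq> d' \<Longrightarrow> proj_dir d' w = []"
  by (induction w) (auto simp: proj_dir_def)

text \<open>A track that has come to block \<open>l\<close> has consulted no later entry of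
  \<open>s\<close>, so cut states above \<open>l\<close> may still be chosen.\<close>

lemma track_cong:
  assumes "track \<delta> s w l q" "\<And>i. i \<le> l \<Longrightarrow> s i = s' i" shows "track \<delta> s' w l q"
  using assms
proof (induction)
  case (track_Nil l)
  then show ?case by (simp add: track_Nil_iff)
next
  case (track_next w l x q')
  then have "track \<delta> s' w l (s' (l + 1))" by simp
  then show ?case using track_next.hyps track_next.prems[of "l + 2"] by (intro track.track_next) auto
qed (auto intro: track.intros)

text \<open>Jumps change \<open>l\<close> by two, so a track keeps its direction; it depends on the
  word only through one projection.\<close>

lemma track_filter: "track \<delta> s w l q \<longleftrightarrow> track \<delta> s (filter (\<lambda>x. fst x = Suc (l mod 2)) w) l q"
proof (induction w arbitrary: l q rule: rev_induct)
  case (snoc x w)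
  show ?case
  proof (cases "fst x = Suc (l mod 2)")
    case True
    have "track \<delta> s w l' p \<longleftrightarrow> track \<delta> s (filter (\<lambda>x. fst x = Suc (l mod 2)) w) l' p"
      if "l = l' + 2" for l' p using snoc[of l' p] that by simp
    then show ?thesis using True snoc[of l] by (auto simp: track_snoc_iff)
  next
    case False
    then show ?thesis using snoc[of l q] by (simp add: track_snoc_iff)
  qed
qed simp

lemma filter_eq_proj_dir: "filter (\<lambda>x. fst x = d) w = map (Pair d) (proj_dir d w)"
  by (induction w) (auto simp: proj_dir_def)

lemma track_proj_dir:
  assumes "track \<delta> s z l q" "proj_dir (Suc (l mod 2)) z = proj_dir (Suc (l mod 2)) w"
  shows "track \<delta> s w l q"
  using assms track_filter[of \<delta> s z l q] track_filter[of \<delta> s w l q] by (simp add: filter_eq_proj_dir)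

text \<open>Peeling off the last block is the induction step of \<open>track_sound\<close>. Only the
  projection of \<open>w\<close> is decomposed, since letters of the other direction may lie in
  between.\<close>

lemma track_split:
  assumes "track \<delta> s w l q"
  shows "\<exists>w0 w1. proj_dir (Suc (l mod 2)) w = proj_dir (Suc (l mod 2)) w0 @ proj_dir (Suc (l mod 2)) w1 \<and>
    set w1 \<subseteq> {Suc (l mod 2)} \<times> UNIV \<and> steps \<delta> (s l) w1 = Some q \<and>
    (if l < 2 then w0 = [] else track \<delta> s w0 (l - 2) (s (l - 1)))"
  using assms
proof (induction)
  case (track_Nil l)
  then show ?case by (intro exI[of _ "[]"]) simp
next
  case (track_skip w l q x)
  then show ?case by simp
next
  case (track_stay w l q x q')
  then obtain w0 w1 where w: "proj_dir (Suc (l mod 2)) w = proj_dir (Suc (l mod 2)) w0 @ proj_dir (Suc (l mod 2)) w1"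
    "set w1 \<subseteq> {Suc (l mod 2)} \<times> UNIV" "steps \<delta> (s l) w1 = Some q"
    "if l < 2 then w0 = [] else track \<delta> s w0 (l - 2) (s (l - 1))" by blast
  then show ?case using track_stay.hyps
    by (intro exI[of _ w0] exI[of _ "w1 @ [x]"]) (cases x, auto simp: steps_append)
next
  case (track_next w l x q')
  then show ?case by (intro exI[of _ w] exI[of _ "[x]"]) (cases x, auto)
qed

text \<open>Two words are allowed because each track sees one projection only. Peeling the last
  block off the track of \<open>w2\<close> leaves a pair of tracks one level lower with exchanged
  roles; so \<open>z\<close> is assembled in the order of the blocks, whatever the interleaving in
  \<open>w1\<close> and \<open>w2\<close>.\<close>

lemma track_sound:
  assumes "track \<delta> s w1 l (s (Suc l))" "track \<delta> s w2 (Suc l) q"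
  shows "\<exists>z. steps \<delta> (s 0) z = Some q \<and> proj_dir (Suc (l mod 2)) z = proj_dir (Suc (l mod 2)) w1 \<and>
    proj_dir (Suc (Suc l mod 2)) z = proj_dir (Suc (Suc l mod 2)) w2"
  using assms
proof (induction l arbitrary: w1 w2 q)
  case 0
  from track_split[OF 0(1)] obtain u where u: "proj_dir 1 w1 = proj_dir 1 u" "set u \<subseteq> {1} \<times> UNIV"
    "steps \<delta> (s 0) u = Some (s 1)" by auto
  from track_split[OF 0(2)] obtain v where v: "proj_dir 2 w2 = proj_dir 2 v" "set v \<subseteq> {2} \<times> UNIV"
    "steps \<delta> (s 1) v = Some q" by (auto simp: numeral_2_eq_2)
  show ?case using u v proj_dir_other[OF u(2), of 2] proj_dir_other[OF v(2), of 1]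
    by (intro exI[of _ "u @ v"]) (auto simp: steps_append numeral_2_eq_2)
next
  case (Suc l)
  let ?d = "Suc (l mod 2)" and ?d' = "Suc (Suc l mod 2)"
  have d: "Suc (Suc (Suc l) mod 2) = ?d" "?d \<noteq> ?d'" by presburger+
  from track_split[OF Suc.prems(2)] obtain v0 v1 where v: "proj_dir ?d w2 = proj_dir ?d v0 @ proj_dir ?d v1"
    "set v1 \<subseteq> {?d} \<times> UNIV" "steps \<delta> (s (Suc (Suc l))) v1 = Some q" "track \<delta> s v0 l (s (Suc l))"
    by (auto simp: d(1))
  from Suc.IH[OF v(4) Suc.prems(1)] obtain z where z: "steps \<delta> (s 0) z = Some (s (Suc (Suc l)))"
    "proj_dir ?d z = proj_dir ?d v0" "proj_dir ?d' z = proj_dir ?d' w1" by blast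
  show ?case unfolding d(1)
    using v z proj_dir_other[OF v(2) d(2)] by (intro exI[of _ "z @ v1"]) (simp add: steps_append)
qed

text \<open>\<open>s j\<close> is the state in which block \<open>j\<close> starts, and
  \<open>Suc l\<close> is the current block. The empty word counts as being in block 1, so a word
  that begins with an input opens block 2 and leaves blocks 0 and 1 empty; this is the level spent
  beyond the number of shifts.\<close>

lemma track_complete:
  assumes \<delta>: "\<forall>q x p. \<delta> q x = Some p \<longrightarrow> (fst x = 1 \<or> fst x = 2) \<and> p < n"
    and q0: "q0 < n" and z: "steps \<delta> q0 z = Some q"
  shows "\<exists>s l. l \<le> shift z + (if z = [] then 0 else 1) \<and> s 0 = q0 \<and> (\<forall>i. s i < n) \<and>
    track \<delta> s z l (s (Suc l)) \<and> track \<delta> s z (Suc l) q \<and> (z \<noteq> [] \<longrightarrow> fst (last z) = Suc (Suc l mod 2))"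
  using z
proof (induction z arbitrary: q rule: rev_induct)
  case Nil
  then show ?case using q0 by (intro exI[of _ "\<lambda>_. q0"] exI[of _ 0]) (simp add: track_Nil_iff)
next
  case (snoc x z)
  then obtain r where r: "steps \<delta> q0 z = Some r" "\<delta> r x = Some q"
    by (auto simp: steps_append split: option.splits)
  obtain s l where sl: "l \<le> shift z + (if z = [] then 0 else 1)" "s 0 = q0" "\<forall>i. s i < n"
    "track \<delta> s z l (s (Suc l))" "track \<delta> s z (Suc l) r" "z \<noteq> [] \<longrightarrow> fst (last z) = Suc (Suc l mod 2)"
    using snoc.IH[OF r(1)] by blast
  have x: "fst x = 1 \<or> fst x = 2" using \<delta> r(2) by blast
  have mono: "shift z \<le> shift (z @ [x])" using shift_append[of z "[x]"] by simp
  show ?case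
  proof (cases "fst x = Suc (Suc l mod 2)")
    case True
    then have ne: "fst x \<noteq> Suc (l mod 2)" by presburger
    have "track \<delta> s (z @ [x]) l (s (Suc l))" using track_skip[OF sl(4) ne] .
    moreover have "track \<delta> s (z @ [x]) (Suc l) q" using track_stay[OF sl(5) True r(2)] .
    moreover have "l \<le> shift (z @ [x]) + 1" using sl(1) mono by (auto split: if_splits)
    ultimately show ?thesis using sl(2,3) True by (intro exI[of _ s] exI[of _ l]) simp
  next
    case False
    then have xl: "fst x = Suc (l mod 2)" using x by presburger
    have rn: "r < n" using steps_lt[of \<delta> n q0 z r] \<delta> q0 r(1) by blast
    \<comment> \<open>The direction changes, so the current state \<open>r\<close> becomes the cut
      state of the new block. Both old tracks consult entries up to \<open>Suc l\<close> only and
      survive the update.\<close>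
    define s' where "s' = s(Suc (Suc l) := r)"
    have t: "track \<delta> s' z l (s' (l + 1))" "track \<delta> s' z (Suc l) r"
      using track_cong[OF sl(4), of s'] track_cong[OF sl(5), of s'] by (simp_all add: s'_def)
    have "track \<delta> s' (z @ [x]) (Suc l) (s' (Suc (Suc l)))"
      using track_skip[OF t(2) False] by (simp add: s'_def)
    moreover have "track \<delta> s' (z @ [x]) (Suc (Suc l)) q"
      using track_next[OF t(1) xl, of q] r(2) by (simp add: s'_def)
    moreover have "Suc l \<le> shift (z @ [x]) + 1"
    proof (cases "z = []")
      case False
      then have "fst (last z) \<noteq> fst x" using sl(6) xl by presburger
      then show ?thesis using shift_snoc[OF False, of x] sl(1) False by simp
    qed (use sl(1) in \<open>simp add: shift_def\<close>)
    moreover have "s' 0 = q0" "\<forall>i. s' i < n" using sl(2,3) rn by (simp_all add: s'_def)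
    ultimately show ?thesis using xl by (intro exI[of _ s'] exI[of _ "Suc l"]) simp
  qed
qed

lemma digits_exist:
  assumes "\<And>i. s i < n" shows "\<exists>t<n ^ m. \<forall>j<m. digit n t j = s j"
  using assms
proof (induction m arbitrary: s)
  case (Suc m)
  have n: "0 < n" using Suc.prems[of 0] by simp
  obtain t where t: "t < n ^ m" "\<forall>j<m. digit n t j = s (Suc j)" using Suc.IH[of "\<lambda>j. s (Suc j)"] Suc.prems by auto
  let ?t = "s 0 + n * t"
  have "?t < n + n * t" using Suc.prems by simp
  also have "\<dots> = n * Suc t" by simp
  also have "\<dots> \<le> n * n ^ m" using t(1) by (intro mult_le_mono2) simp
  finally have "?t < n ^ Suc m" by simp
  moreover have "digit n ?t j = s j" if "j < Suc m" for j
  proof (cases j)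
    case 0
    then show ?thesis using Suc.prems[of 0] by (simp add: digit_def)
  next
    case (Suc i)
    have "?t div n ^ Suc i = t div n ^ i" using n Suc.prems[of 0] by (simp add: div_mult2_eq)
    then show ?thesis using Suc t(2) that by (simp add: digit_def)
  qed
  ultimately show ?case by blast
qed simp

text \<open>A witness \<open>z\<close> in the language may interleave its letters quite differently
  from \<open>w\<close>, but each track reads one projection only, and these agree. Conversely the
  two tracks of \<open>w\<close> are merged by \<open>track_sound\<close>. The ranges of
  \<open>t\<close> and \<open>l\<close> suffice by \<open>shift_bound\<close>.\<close>

lemma sem_in_sem_set_iff:
  assumes A: "dfa_wf k A" "states A = {0..<n}" and fs: "finite_shift (lang A)"
  shows "sem w \<in> sem_set (lang A) \<longleftrightarrow> (\<exists>t<n ^ (2 * n + 4). \<exists>l<2 * n + 4. Suc l < 2 * n + 4 \<and>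
    digit n t 0 = init A \<and> track (delta A) (digit n t) w l (digit n t (Suc l)) \<and>
    track (delta A) (digit n t) w (Suc l) (digit n t (l + 2)) \<and> digit n t (l + 2) \<in> finals A)"
    (is "?L \<longleftrightarrow> ?R")
proof
  assume ?L
  then obtain z where z: "z \<in> lang A" "sem z = sem w" by (auto simp: sem_set_def)
  then have pr: "proj_dir 1 z = proj_dir 1 w" "proj_dir 2 z = proj_dir 2 w"
    by (simp_all add: sem_def proj_i_eq proj_o_eq)
  have pr': "proj_dir (Suc (m mod 2)) z = proj_dir (Suc (m mod 2)) w" for m
  proof -
    have "Suc (m mod 2) = 1 \<or> Suc (m mod 2) = 2" by presburger
    then show ?thesis using pr by metis
  qed
  obtain q where q: "steps (delta A) (init A) z = Some q" "q \<in> finals A" using z by (auto simp: lang_def)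
  have \<delta>: "(fst x = 1 \<or> fst x = 2) \<and> p < n" if qx: "delta A r x = Some p" for r x p
  proof -
    have "x \<in> Sigma_io k \<and> p \<in> states A" using A(1) qx unfolding dfa_wf_def by blast
    then show ?thesis using A(2) by (auto simp: Sigma_io_def)
  qed
  have i: "init A < n" using A by (simp add: dfa_wf_def)
  obtain s l where s: "l \<le> shift z + (if z = [] then 0 else 1)" "s 0 = init A" "\<forall>i. s i < n"
    "track (delta A) s z l (s (Suc l))" "track (delta A) s z (Suc l) q"
    using track_complete[OF _ i q(1)] \<delta> by blast
  have qn: "q < n" using q(2) A by (auto simp: dfa_wf_def)
  \<comment> \<open>\<open>track_complete\<close> says nothing about where the last block ends;
    storing the accepting state \<open>q\<close> in the next entry lets the tuple record it.\<close>
  define s' where "s' = s(Suc (Suc l) := q)"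
  have "\<And>i. s' i < n" using s(3) qn by (simp add: s'_def)
  then obtain t where t: "t < n ^ (2 * n + 4)" "\<forall>j<2 * n + 4. digit n t j = s' j"
    using digits_exist[of s' n "2 * n + 4"] by blast
  have "shift z \<le> 2 * n" using shift_bound[OF A(1) fs z(1)] A(2) by simp
  then have l: "Suc (Suc l) < 2 * n + 4" using s(1) by (auto split: if_splits)
  have e: "digit n t j = s j" if "j \<le> Suc l" for j using t(2) that l by (simp add: s'_def)
  have "track (delta A) (digit n t) w l (digit n t (Suc l))"
    using track_proj_dir[OF track_cong[OF s(4), of "digit n t"] pr'] e by simp
  moreover have "track (delta A) (digit n t) w (Suc l) q"
    using track_proj_dir[OF track_cong[OF s(5), of "digit n t"] pr'] e by simp
  moreover have "digit n t (l + 2) = q" using t(2) l by (simp add: s'_def)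
  ultimately show ?R using t(1) l q(2) e[of 0] s(2) by (intro exI[of _ t] exI[of _ l] conjI) auto
next
  assume ?R
  then obtain t l where t: "digit n t 0 = init A" "track (delta A) (digit n t) w l (digit n t (Suc l))"
    "track (delta A) (digit n t) w (Suc l) (digit n t (l + 2))" "digit n t (l + 2) \<in> finals A" by blast
  from track_sound[OF t(2,3)] obtain z where z: "steps (delta A) (init A) z = Some (digit n t (l + 2))"
    "proj_dir (Suc (l mod 2)) z = proj_dir (Suc (l mod 2)) w" "proj_dir (Suc (Suc l mod 2)) z = proj_dir (Suc (Suc l mod 2)) w"
    unfolding t(1) by blast
  have "z \<in> lang A" using z(1) t(4) by (auto simp: lang_def)
  moreover have "sem z = sem w"
  proof -
    have "Suc (l mod 2) = 1 \<and> Suc (Suc l mod 2) = 2 \<or> Suc (l mod 2) = 2 \<and> Suc (Suc l mod 2) = 1"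
      by presburger
    then show ?thesis unfolding sem_def proj_i_eq proj_o_eq using z(2,3) by metis
  qed
  ultimately show ?L unfolding sem_set_def by (metis imageI)
qed

section \<open>Correctness of the encoding\<close>

lemma set_encode_less: "A \<subseteq> {..<m} \<Longrightarrow> set_encode A < 2 ^ m"
proof -
  assume A: "A \<subseteq> {..<m}"
  have "set_encode A \<le> (\<Sum>i<m. 2 ^ i)"
    unfolding set_encode_def using A by (intro sum_mono2) auto
  also have "(\<Sum>i<m. 2 ^ i) < (2 ^ m :: nat)" by (induction m) auto
  finally show ?thesis .
qed

lemma mem_less: assumes "mem x X" "X < 2 ^ m" shows "x < m"
proof -
  have "X div 2 ^ x \<noteq> 0" using assms(1) unfolding mem_def by (metis even_zero)
  then have "(2 :: nat) ^ x \<le> X" by (metis div_less not_le)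
  then have "(2 :: nat) ^ x < 2 ^ m" using assms(2) by (rule le_less_trans)
  then show ?thesis by simp
qed

lemma mem_set_encode: "finite A \<Longrightarrow> mem x (set_encode A) \<longleftrightarrow> x \<in> A"
  by (simp add: mem_iff)

text \<open>A number is determined by its bits, so the bitwise conditions of \<open>pos_init\<close>
  and \<open>pos_step\<close> have exactly one solution below the bound.\<close>

lemma eq_set_encode_iff:
  assumes "X < 2 ^ m"
  shows "X = set_encode {y. y < m \<and> P y} \<longleftrightarrow> (\<forall>y<m. mem y X \<longleftrightarrow> P y)"
proof
  assume "\<forall>y<m. mem y X \<longleftrightarrow> P y"
  then have "set_decode X = {y. y < m \<and> P y}" using mem_less[OF _ assms] by (auto simp: mem_iff)
  then show "X = set_encode {y. y < m \<and> P y}" by (metis set_decode_inverse)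
qed (simp add: mem_set_encode)

text \<open>Subsets of \<open>{..<m}\<close> are the numbers below \<open>2 ^ m\<close>, which turns
  the quantifier over all closed sets into a bounded one; the set of everything reachable from
  \<open>q\<close> is itself one of these closed sets.\<close>

lemma closed_codes_iff_rtranclp:
  assumes q: "q < m" and r: "\<And>x y. r x y \<Longrightarrow> y < m"
  shows "(\<forall>R<2 ^ m. mem q R \<and> (\<forall>x<m. \<forall>y<m. mem x R \<and> r x y \<longrightarrow> mem y R) \<longrightarrow> mem q' R) \<longleftrightarrow> r\<^sup>*\<^sup>* q q'"
    (is "?L \<longleftrightarrow> _")
proof
  assume L: ?L
  let ?R = "{y. y < m \<and> r\<^sup>*\<^sup>* q y}"
  have m: "mem y (set_encode ?R) \<longleftrightarrow> y < m \<and> r\<^sup>*\<^sup>* q y" for y by (simp add: mem_set_encode)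
  have "set_encode ?R < 2 ^ m" by (rule set_encode_less) auto
  moreover have "mem q (set_encode ?R) \<and>
      (\<forall>x<m. \<forall>y<m. mem x (set_encode ?R) \<and> r x y \<longrightarrow> mem y (set_encode ?R))"
    unfolding m using q by (auto intro: rtranclp.rtrancl_into_rtrancl)
  ultimately have "mem q' (set_encode ?R)" using L by blast
  then show "r\<^sup>*\<^sup>* q q'" unfolding m by blast
next
  assume "r\<^sup>*\<^sup>* q q'"
  then show ?L
  proof (induction)
    case (step y z)
    have "y < m" using step.hyps(1) q r by (metis rtranclp.cases)
    then show ?case using step r[OF step.hyps(2)] by blast
  qed blast
qed

lemma rtranclp_iff_steps:
  "(\<lambda>x y. \<exists>a. P a \<and> \<delta> x a = Some y)\<^sup>*\<^sup>* q q' \<longleftrightarrow> (\<exists>w. (\<forall>a\<in>set w. P a) \<and> steps \<delta> q w = Some q')"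
    (is "?r\<^sup>*\<^sup>* q q' \<longleftrightarrow> _")
proof
  assume "?r\<^sup>*\<^sup>* q q'"
  then show "\<exists>w. (\<forall>a\<in>set w. P a) \<and> steps \<delta> q w = Some q'"
  proof (induction)
    case base
    show ?case by (rule exI[of _ "[]"]) simp
  next
    case (step y z)
    then obtain w a where "\<forall>a\<in>set w. P a" "steps \<delta> q w = Some y" "P a" "\<delta> y a = Some z" by blast
    then show ?case by (intro exI[of _ "w @ [a]"]) (auto simp: steps_append)
  qed
next
  assume "\<exists>w. (\<forall>a\<in>set w. P a) \<and> steps \<delta> q w = Some q'"
  then obtain w where "\<forall>a\<in>set w. P a" "steps \<delta> q w = Some q'" by blast
  then show "?r\<^sup>*\<^sup>* q q'"
  proof (induction w arbitrary: q)
    case (Cons a w)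
    then obtain p where p: "\<delta> q a = Some p" "steps \<delta> p w = Some q'" by (auto split: option.splits)
    then have "?r\<^sup>*\<^sup>* p q'" using Cons by simp
    moreover have "?r q p" using p(1) Cons.prems(1) by (metis list.set_intros(1))
    ultimately show ?case by (rule converse_rtranclp_into_rtranclp[rotated])
  qed simp
qed

lemma rtranclp_iff_foldl:
  "(\<lambda>x y. \<exists>a\<in>A. y = f x a)\<^sup>*\<^sup>* p p' \<longleftrightarrow> (\<exists>w\<in>lists A. p' = foldl f p w)" (is "?r\<^sup>*\<^sup>* p p' \<longleftrightarrow> _")
proof
  assume "?r\<^sup>*\<^sup>* p p'"
  then show "\<exists>w\<in>lists A. p' = foldl f p w"
  proof (induction)
    case base
    show ?case by (rule bexI[of _ "[]"]) simp_all
  next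
    case (step y z)
    then obtain w a where "w \<in> lists A" "y = foldl f p w" "a \<in> A" "z = f y a" by blast
    then show ?case by (intro bexI[of _ "w @ [a]"]) auto
  qed
next
  assume "\<exists>w\<in>lists A. p' = foldl f p w"
  then obtain w where "w \<in> lists A" "p' = foldl f p w" by blast
  then show "?r\<^sup>*\<^sup>* p p'"
  proof (induction w arbitrary: p' rule: rev_induct)
    case (snoc a w)
    then have "?r\<^sup>*\<^sup>* p (foldl f p w)" by simp
    moreover have "?r (foldl f p w) p'" using snoc.prems by auto
    ultimately show ?case by (rule rtranclp.rtrancl_into_rtrancl)
  qed simp
qed

lemma prod_encode_mono: "a \<le> a' \<Longrightarrow> b \<le> b' \<Longrightarrow> prod_encode (a, b) \<le> prod_encode (a', b')"
  unfolding prod_encode_def triangle_def prod.case by (intro add_mono div_le_mono mult_le_mono) auto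

lemma prod_encode_strict_mono: "a < a' \<Longrightarrow> b \<le> b' \<Longrightarrow> prod_encode (a, b) < prod_encode (a', b')"
  using prod_encode_mono[of a a' b b'] by (simp add: less_le prod_encode_eq)

lemma node_less:
  "kd < kd' \<Longrightarrow> t \<le> t' \<Longrightarrow> l \<le> l' \<Longrightarrow> q \<le> q' \<Longrightarrow> node kd t l q < node kd' t' l' q'"
  unfolding node_def by (intro prod_encode_strict_mono prod_encode_mono)

lemma node_eq_iff [simp]: "node kd t l q = node kd' t' l' q' \<longleftrightarrow> kd = kd' \<and> t = t' \<and> l = l' \<and> q = q'"
  by (auto simp: node_def)

section \<open>Decoding the given automata\<close>

lemma encode_code_simps:
  "num_states (encode_code (n, q0, F, tb)) = n" "start_state (encode_code (n, q0, F, tb)) = q0"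
  "final_list (encode_code (n, q0, F, tb)) = list_encode F"
  "table (encode_code (n, q0, F, tb)) = list_encode tb"
  by (simp_all add: num_states_def start_state_def final_list_def table_def)

lemma encode_input_simps [simp]:
  "alph (encode_input k cS cT) = k" "autS (encode_input k cS cT) = encode_code cS"
  "autT (encode_input k cS cT) = encode_code cT"
  by (simp_all add: encode_input_def alph_def autS_def autT_def)

lemma dfa_of_wf: "code_valid k c \<Longrightarrow> dfa_wf k (dfa_of k c)"
  by (cases c) (auto simp: dfa_wf_def Sigma_io_def split: if_splits)

lemma states_dfa_of: "states (dfa_of k c) = {0..<num_states (encode_code c)}"
  by (cases c) (simp add: encode_code_simps del: encode_code.simps)

lemma start_encode_code: "start_state (encode_code c) = init (dfa_of k c)"
  by (cases c) (simp add: encode_code_simps del: encode_code.simps)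

lemma code_mem_final_list: "code_mem q (final_list (encode_code c)) \<longleftrightarrow> q \<in> finals (dfa_of k c)"
  by (cases c) (simp add: encode_code_simps code_mem_list_encode del: encode_code.simps)

lemma trans_encode_code:
  assumes "code_valid k c"
  shows "table_trans k (encode_code c) q i a q' \<longleftrightarrow> delta (dfa_of k c) q (i, a) = Some q'"
proof -
  obtain n q0 F tb where c: "c = (n, q0, F, tb)" by (cases c)
  \<comment> \<open>Decoding agrees with \<open>!\<close> at indices inside the list; the table
    length demanded by \<open>code_valid\<close> provides this.\<close>
  have idx: "q * (2 * k) + (i - 1) * k + a < length tb" if "q < n" "i = 1 \<or> i = 2" "a < k"
  proof -
    have "(i - 1) * k + a < 2 * k" using that(2,3) by auto
    moreover have "Suc q * (2 * k) \<le> n * (2 * k)" using that(1) by (intro mult_le_mono1) simp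
    ultimately show ?thesis using assms c by simp
  qed
  show ?thesis
    using idx code_nth_list_encode[of "q * (2 * k) + (i - 1) * k + a" tb]
    by (auto simp: c table_trans_def encode_code_simps simp del: encode_code.simps)
qed

lemma proj_i_snoc_split:
  "w \<in> lists (Sigma_io k) \<Longrightarrow> proj_i w = u @ [a] \<Longrightarrow>
    \<exists>w' y. w = w' @ (1, a) # y \<and> proj_i w' = u \<and> (\<forall>b\<in>set y. fst b = 2)"
proof (induction w rule: rev_induct)
  case (snoc x w)
  show ?case
  proof (cases "fst x = 1")
    case True
    then have "snd x = a" "proj_i w = u" using snoc.prems by auto
    then show ?thesis using True by (intro exI[of _ w] exI[of _ "[]"]) (cases x, auto)
  next
    case False
    then obtain w' y where "w = w' @ (1, a) # y" "proj_i w' = u" "\<forall>b\<in>set y. fst b = 2"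
      using snoc by auto
    moreover have "fst x = 2" using False snoc.prems by (auto simp: Sigma_io_def)
    ultimately show ?thesis by (intro exI[of _ w'] exI[of _ "y @ [x]"]) auto
  qed
qed simp

lemma proj_i_append_split: "proj_i w = u @ u' \<Longrightarrow> \<exists>w' y. w = w' @ y \<and> proj_i w' = u"
proof (induction w arbitrary: u)
  case (Cons x w)
  show ?case
  proof (cases "u = [] \<or> fst x \<noteq> 1")
    case True
    then show ?thesis
    proof
      assume "u = []"
      then show ?thesis by (intro exI[of _ "[]"] exI[of _ "x # w"]) simp
    next
      assume x: "fst x \<noteq> 1"
      then obtain w' y where "w = w' @ y" "proj_i w' = u" using Cons.IH[of u] Cons.prems by auto
      then show ?thesis using x by (intro exI[of _ "x # w'"] exI[of _ y]) simp
    qed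
  next
    case False
    then obtain a v where u: "u = a # v" by (cases u) auto
    then obtain w' y where "w = w' @ y" "proj_i w' = v" using Cons.IH[of v] Cons.prems False by auto
    then show ?thesis using False u Cons.prems by (intro exI[of _ "x # w'"] exI[of _ y]) simp
  qed
qed simp

lemma Domain_sem_set: "u \<in> Domain (sem_set L) \<longleftrightarrow> (\<exists>w\<in>L. proj_i w = u)"
  by (force simp: sem_set_def sem_def)

locale uniformization_input =
  fixes k :: nat and cS cT :: dfa_code
  assumes validS: "code_valid k cS" and validT: "code_valid k cT"
    and fin_shift: "finite_shift (lang (dfa_of k cS))"
begin

abbreviation "v \<equiv> encode_input k cS cT"
abbreviation "AS \<equiv> dfa_of k cS"
abbreviation "AT \<equiv> dfa_of k cT"
abbreviation "n \<equiv> num_states (encode_code cS)"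
abbreviation "nT \<equiv> num_states (encode_code cT)"
abbreviation "M \<equiv> node_bound v"

lemma trans_v [simp]:
  "table_trans k (encode_code cS) q i a q' \<longleftrightarrow> delta AS q (i, a) = Some q'"
  "table_trans k (encode_code cT) q i a q' \<longleftrightarrow> delta AT q (i, a) = Some q'"
  by (simp_all add: trans_encode_code validS validT)

lemma delta_dest:
  "delta AS q x = Some q' \<Longrightarrow> q < n \<and> x \<in> Sigma_io k \<and> q' < n"
  "delta AT q x = Some q' \<Longrightarrow> q < nT \<and> x \<in> Sigma_io k \<and> q' < nT"
proof -
  show "delta AS q x = Some q' \<Longrightarrow> q < n \<and> x \<in> Sigma_io k \<and> q' < n"
    using dfa_of_wf[OF validS] unfolding dfa_wf_def states_dfa_of by (metis atLeastLessThan_iff)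
  show "delta AT q x = Some q' \<Longrightarrow> q < nT \<and> x \<in> Sigma_io k \<and> q' < nT"
    using dfa_of_wf[OF validT] unfolding dfa_wf_def states_dfa_of by (metis atLeastLessThan_iff)
qed

lemma init_less: "init AS < n" "init AT < nT"
  using dfa_of_wf[OF validS] dfa_of_wf[OF validT] states_dfa_of[of k cS] states_dfa_of[of k cT]
  by (auto simp: dfa_wf_def)

lemma steps_less:
  "steps (delta AS) (init AS) w = Some q \<Longrightarrow> q < n" "steps (delta AT) (init AT) w = Some q \<Longrightarrow> q < nT"
  using steps_lt[of "delta AS" n "init AS" w q] steps_lt[of "delta AT" nT "init AT" w q]
    delta_dest init_less by blast+

lemma finals_less: "q \<in> finals AS \<Longrightarrow> q < n" "q \<in> finals AT \<Longrightarrow> q < nT"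
  using dfa_of_wf[OF validS] dfa_of_wf[OF validT] states_dfa_of[of k cS] states_dfa_of[of k cT]
  by (auto simp: dfa_wf_def)

lemma reach_iff:
  assumes "q < n"
  shows "reach v d q q' \<longleftrightarrow> (\<exists>w. (\<forall>x\<in>set w. d = 0 \<or> fst x = d) \<and> steps (delta AS) q w = Some q')"
proof -
  let ?r = "\<lambda>x y. \<exists>a. (d = 0 \<or> fst a = d) \<and> delta AS x a = Some y"
  \<comment> \<open>The bounds on direction and symbol lose nothing, as transitions exist only for
    letters of \<open>Sigma_io k\<close>.\<close>
  have eq: "(\<forall>i<3. \<forall>a<k. mem x R \<and> (d = 0 \<or> i = d) \<and> delta AS x (i, a) = Some y \<longrightarrow> mem y R) \<longleftrightarrow>
      (mem x R \<and> ?r x y \<longrightarrow> mem y R)" for x y R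
  proof -
    have "i < 3 \<and> a < k" if "delta AS x (i, a) = Some y" for i a
      using delta_dest(1)[OF that] by (auto simp: Sigma_io_def)
    then show ?thesis by auto
  qed
  have "reach v d q q' \<longleftrightarrow> (\<forall>R<2 ^ n. mem q R \<and> (\<forall>x<n. \<forall>y<n. mem x R \<and> ?r x y \<longrightarrow> mem y R) \<longrightarrow> mem q' R)"
    unfolding reach_def encode_input_simps trans_v eq ..
  also have "\<dots> \<longleftrightarrow> ?r\<^sup>*\<^sup>* q q'"
    by (rule closed_codes_iff_rtranclp) (use assms delta_dest in auto)
  finally show ?thesis unfolding rtranclp_iff_steps .
qed

section \<open>Positions as a subset construction\<close>

definition stp :: "nat \<Rightarrow> letter \<Rightarrow> nat" where
  "stp X x = set_encode {y. y < M \<and> (\<exists>z<M. mem z X \<and> nstep v z (fst x) (snd x) y)}"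

definition p0 :: nat where "p0 = set_encode {z. z < M \<and> ninit v z}"

lemma stp_less: "stp X x < 2 ^ M" unfolding stp_def by (rule set_encode_less) auto
lemma p0_less: "p0 < 2 ^ M" unfolding p0_def by (rule set_encode_less) auto

lemma pos_step_iff: "Y < 2 ^ M \<Longrightarrow> pos_step v X i a Y \<longleftrightarrow> Y = stp X (i, a)"
  unfolding stp_def fst_conv snd_conv pos_step_def by (rule eq_set_encode_iff[symmetric])

lemma pos_init_iff: "X < 2 ^ M \<Longrightarrow> pos_init v X \<longleftrightarrow> X = p0"
  unfolding p0_def pos_init_def by (rule eq_set_encode_iff[symmetric])

lemma mem_stp: "mem y (stp X x) \<longleftrightarrow> y < M \<and> (\<exists>z<M. mem z X \<and> nstep v z (fst x) (snd x) y)"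
  unfolding stp_def by (subst mem_set_encode) auto

lemma mem_p0: "mem y p0 \<longleftrightarrow> y < M \<and> ninit v y"
  unfolding p0_def by (subst mem_set_encode) auto

lemma node_less_M:
  "q < nT \<Longrightarrow> node 0 0 0 q < M" "q < n \<Longrightarrow> node (Suc 0) 0 0 q < M"
  "t < tuple_bound v \<Longrightarrow> l < cut_bound v \<Longrightarrow> q < n \<Longrightarrow> node 2 t l q < M"
  unfolding node_bound_def state_bound_def by (rule node_less; simp)+

lemma digit_less: "digit n t j < n"
  using init_less(1) by (simp add: digit_def)

lemma track_less:
  assumes "track (delta AS) (digit n t) w l q" shows "q < n"
  using assms
proof (induction)
  case (track_Nil l)
  show ?case by (rule digit_less)
next
  case (track_stay w l q x q')
  then show ?case using delta_dest(1) by blast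
next
  case (track_next w l x q')
  then show ?case using delta_dest(1) by blast
qed

text \<open>The kind is part of the code, so only one of the three step relations can lead to a
  given node.\<close>

lemma nstep_iff:
  "nstep v z i a (node 0 0 0 q') \<longleftrightarrow> (\<exists>q. z = node 0 0 0 q \<and> delta AT q (i, a) = Some q')"
  "nstep v z i a (node (Suc 0) 0 0 q') \<longleftrightarrow> (\<exists>q<n. q' < n \<and> z = node (Suc 0) 0 0 q \<and>
     (i = 2 \<and> q' = q \<or> i = 1 \<and> (\<exists>p. delta AS q (1, a) = Some p \<and> reach v 2 p q')))"
  "nstep v z i a (node 2 t l' q') \<longleftrightarrow> t < tuple_bound v \<and> l' < cut_bound v \<and> q' < n \<and>
     (\<exists>l<cut_bound v. \<exists>q<n. z = node 2 t l q \<and>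
       (i \<noteq> Suc (l mod 2) \<and> l' = l \<and> q' = q \<or>
        i = Suc (l mod 2) \<and> l' = l \<and> delta AS q (i, a) = Some q' \<or>
        i = Suc (l mod 2) \<and> l' = l + 2 \<and> q = digit n t (l + 1) \<and>
          delta AS (digit n t (l + 2)) (i, a) = Some q'))"
proof -
  show "nstep v z i a (node 0 0 0 q') \<longleftrightarrow> (\<exists>q. z = node 0 0 0 q \<and> delta AT q (i, a) = Some q')"
    using delta_dest(2)[of _ "(i, a)" q']
    by (auto simp: nstep_def nstep_T_def nstep_D_def nstep_cut_def)
  show "nstep v z i a (node (Suc 0) 0 0 q') \<longleftrightarrow> (\<exists>q<n. q' < n \<and> z = node (Suc 0) 0 0 q \<and>
     (i = 2 \<and> q' = q \<or> i = 1 \<and> (\<exists>p. delta AS q (1, a) = Some p \<and> reach v 2 p q')))"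
    using delta_dest(1)[of _ "(1, a)"]
    by (auto simp: nstep_def nstep_T_def nstep_D_def nstep_cut_def)
  show "nstep v z i a (node 2 t l' q') \<longleftrightarrow> t < tuple_bound v \<and> l' < cut_bound v \<and> q' < n \<and>
     (\<exists>l<cut_bound v. \<exists>q<n. z = node 2 t l q \<and>
       (i \<noteq> Suc (l mod 2) \<and> l' = l \<and> q' = q \<or>
        i = Suc (l mod 2) \<and> l' = l \<and> delta AS q (i, a) = Some q' \<or>
        i = Suc (l mod 2) \<and> l' = l + 2 \<and> q = digit n t (l + 1) \<and>
          delta AS (digit n t (l + 2)) (i, a) = Some q'))"
    unfolding nstep_def nstep_T_def nstep_D_def nstep_cut_def node_eq_iff encode_input_simps trans_v
    by auto
qed

lemma ninit_iff:
  "ninit v (node 0 0 0 q) \<longleftrightarrow> q = init AT"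
  "ninit v (node (Suc 0) 0 0 q) \<longleftrightarrow> q < n \<and> reach v 2 (init AS) q"
  "ninit v (node 2 t l q) \<longleftrightarrow> t < tuple_bound v \<and> digit n t 0 = init AS \<and> l < 2 \<and> q = digit n t l"
  by (auto simp: ninit_def start_encode_code[of _ k] less_2_cases_iff)

lemma mem_node_T:
  "mem (node 0 0 0 q) (foldl stp p0 w) \<longleftrightarrow> steps (delta AT) (init AT) w = Some q"
proof (induction w arbitrary: q rule: rev_induct)
  case Nil
  show ?case using init_less(2) node_less_M(1) by (auto simp: mem_p0 ninit_iff)
next
  case (snoc x w)
  obtain i a where x: "x = (i, a)" by force
  have "mem (node 0 0 0 q) (stp (foldl stp p0 w) x) \<longleftrightarrow>
      (\<exists>p. mem (node 0 0 0 p) (foldl stp p0 w) \<and> delta AT p x = Some q)"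
    using node_less_M(1) delta_dest(2)[of _ x q] unfolding mem_stp x fst_conv snd_conv nstep_iff by blast
  then show ?case using snoc by (auto simp: steps_append split: option.splits)
qed

text \<open>\<open>w'\<close> shares only its inputs with \<open>w\<close>. For one more input
  letter, a run is split at its last input; what follows consists of outputs and is covered by
  \<open>reach v 2\<close>.\<close>

lemma mem_node_D:
  assumes "w \<in> lists (Sigma_io k)"
  shows "mem (node 1 0 0 q) (foldl stp p0 w) \<longleftrightarrow>
    (\<exists>w'. steps (delta AS) (init AS) w' = Some q \<and> proj_i w' = proj_i w)"
  using assms
proof (induction w arbitrary: q rule: rev_induct)
  case Nil
  have "(\<forall>x\<in>set w'. (2::nat) = 0 \<or> fst x = 2) \<longleftrightarrow> proj_i w' = []"
    if "steps (delta AS) (init AS) w' = Some q" for w'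
  proof -
    have "w' \<in> lists (Sigma_io k)" using steps_letters[OF dfa_of_wf[OF validS]] that by blast
    then show ?thesis by (induction w') (auto simp: Sigma_io_def)
  qed
  then have "reach v 2 (init AS) q \<longleftrightarrow> (\<exists>w'. steps (delta AS) (init AS) w' = Some q \<and> proj_i w' = [])"
    unfolding reach_iff[OF init_less(1)] by blast
  then show ?case using node_less_M(2) steps_less(1) by (auto simp: mem_p0 ninit_iff)
next
  case (snoc x w)
  obtain i a where x: "x = (i, a)" by force
  have w: "w \<in> lists (Sigma_io k)" and i: "i = 1 \<or> i = 2"
    using snoc.prems x by (auto simp: Sigma_io_def)
  note IH = snoc.IH[OF w, unfolded One_nat_def]
  have m: "mem (node (Suc 0) 0 0 q) (stp (foldl stp p0 w) x) \<longleftrightarrow>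
      (\<exists>p<n. q < n \<and> mem (node (Suc 0) 0 0 p) (foldl stp p0 w) \<and>
        (i = 2 \<and> q = p \<or> i = 1 \<and> (\<exists>r. delta AS p (1, a) = Some r \<and> reach v 2 r q)))"
    using node_less_M(2) unfolding mem_stp x fst_conv snd_conv nstep_iff by blast
  from i show ?case
  proof
    assume i: "i = 2"
    then have "mem (node (Suc 0) 0 0 q) (stp (foldl stp p0 w) x) \<longleftrightarrow>
        q < n \<and> mem (node (Suc 0) 0 0 q) (foldl stp p0 w)" unfolding m by auto
    then show ?thesis using IH[of q] steps_less(1) i x by auto
  next
    assume i: "i = 1"
    have "mem (node (Suc 0) 0 0 q) (stp (foldl stp p0 w) x) \<longleftrightarrow>
       (\<exists>w'. steps (delta AS) (init AS) w' = Some q \<and> proj_i w' = proj_i w @ [a])"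
    proof
      assume "mem (node (Suc 0) 0 0 q) (stp (foldl stp p0 w) x)"
      then obtain p r where p: "mem (node (Suc 0) 0 0 p) (foldl stp p0 w)" "delta AS p (1, a) = Some r"
        "reach v 2 r q" unfolding m using i by auto
      obtain w' where w': "steps (delta AS) (init AS) w' = Some p" "proj_i w' = proj_i w"
        using p(1) IH by blast
      have "r < n" using delta_dest(1)[OF p(2)] by blast
      then obtain y where y: "\<forall>x\<in>set y. fst x = 2" "steps (delta AS) r y = Some q"
        using p(3) reach_iff by auto
      have "proj_i y = []" using y(1) by (induction y) auto
      then show "\<exists>w'. steps (delta AS) (init AS) w' = Some q \<and> proj_i w' = proj_i w @ [a]"
        using w' y(2) p(2) by (intro exI[of _ "w' @ (1, a) # y"]) (simp add: steps_append)
    next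
      assume "\<exists>w'. steps (delta AS) (init AS) w' = Some q \<and> proj_i w' = proj_i w @ [a]"
      then obtain w1 where w1: "steps (delta AS) (init AS) w1 = Some q" "proj_i w1 = proj_i w @ [a]" by blast
      have "w1 \<in> lists (Sigma_io k)" using steps_letters[OF dfa_of_wf[OF validS]] w1(1) by blast
      then obtain w' y where w': "w1 = w' @ (1, a) # y" "proj_i w' = proj_i w" "\<forall>b\<in>set y. fst b = 2"
        using proj_i_snoc_split[OF _ w1(2)] by blast
      then obtain p r where p: "steps (delta AS) (init AS) w' = Some p" "delta AS p (1, a) = Some r"
        "steps (delta AS) r y = Some q"
        using w1(1) by (auto simp: steps_append split: option.splits)
      have "r < n" "p < n" using delta_dest(1)[OF p(2)] by blast+
      then have "reach v 2 r q" using reach_iff p(3) w'(3) by auto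
      moreover have "mem (node (Suc 0) 0 0 p) (foldl stp p0 w)" using IH w'(2) p(1) by blast
      moreover have "q < n" using steps_less(1) w1(1) by blast
      ultimately show "mem (node (Suc 0) 0 0 q) (stp (foldl stp p0 w) x)"
        unfolding m using i p(2) \<open>p < n\<close> by blast
    qed
    then show ?thesis using i x by simp
  qed
qed

text \<open>All guesses \<open>t\<close> are kept side by side and evolve as \<open>track\<close>
  does; \<open>track_less\<close> supplies the bound on states that nodes require.\<close>

lemma mem_node_cut:
  "mem (node 2 t l q) (foldl stp p0 w) \<longleftrightarrow> t < tuple_bound v \<and> l < cut_bound v \<and>
    digit n t 0 = init AS \<and> track (delta AS) (digit n t) w l q"
proof (induction w arbitrary: l q rule: rev_induct)
  case Nil
  show ?case using node_less_M(3)[of t l q] digit_less[of t l]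
    by (auto simp: mem_p0 ninit_iff track_Nil_iff cut_bound_def)
next
  case (snoc x w)
  obtain i a where x: "x = (i, a)" by force
  have m: "mem (node 2 t l q) (stp (foldl stp p0 w) x) \<longleftrightarrow>
     t < tuple_bound v \<and> l < cut_bound v \<and> q < n \<and>
     (\<exists>l'<cut_bound v. \<exists>p<n. mem (node 2 t l' p) (foldl stp p0 w) \<and>
       (fst x \<noteq> Suc (l' mod 2) \<and> l = l' \<and> q = p \<or>
        fst x = Suc (l' mod 2) \<and> l = l' \<and> delta AS p x = Some q \<or>
        fst x = Suc (l' mod 2) \<and> l = l' + 2 \<and> p = digit n t (l' + 1) \<and>
          delta AS (digit n t (l' + 2)) x = Some q))" (is "_ \<longleftrightarrow> ?R")
    using node_less_M(3) unfolding mem_stp x fst_conv snd_conv nstep_iff by blast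
  show ?case
  proof
    assume "mem (node 2 t l q) (foldl stp p0 (w @ [x]))"
    then have ?R using m by simp
    then obtain l' p where h: "t < tuple_bound v" "l < cut_bound v" "mem (node 2 t l' p) (foldl stp p0 w)"
       "fst x \<noteq> Suc (l' mod 2) \<and> l = l' \<and> q = p \<or>
        fst x = Suc (l' mod 2) \<and> l = l' \<and> delta AS p x = Some q \<or>
        fst x = Suc (l' mod 2) \<and> l = l' + 2 \<and> p = digit n t (l' + 1) \<and>
          delta AS (digit n t (l' + 2)) x = Some q" by blast
    then have "digit n t 0 = init AS" "track (delta AS) (digit n t) w l' p" using snoc.IH by blast+
    then show "t < tuple_bound v \<and> l < cut_bound v \<and> digit n t 0 = init AS \<and>
        track (delta AS) (digit n t) (w @ [x]) l q"
      using h(1,2,4) by (auto intro: track_skip track_stay track_next simp del: add_2_eq_Suc')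
  next
    assume h: "t < tuple_bound v \<and> l < cut_bound v \<and> digit n t 0 = init AS \<and>
        track (delta AS) (digit n t) (w @ [x]) l q"
    then have qn: "q < n" using track_less by blast
    have "\<exists>l' p. l' < cut_bound v \<and> track (delta AS) (digit n t) w l' p \<and>
       (fst x \<noteq> Suc (l' mod 2) \<and> l = l' \<and> q = p \<or>
        fst x = Suc (l' mod 2) \<and> l = l' \<and> delta AS p x = Some q \<or>
        fst x = Suc (l' mod 2) \<and> l = l' + 2 \<and> p = digit n t (l' + 1) \<and>
          delta AS (digit n t (l' + 2)) x = Some q)"
      using h unfolding track_snoc_iff
    proof (elim conjE disjE exE)
      fix l' assume "l < cut_bound v" "l = l' + 2" "fst x = Suc (l mod 2)"
        "track (delta AS) (digit n t) w l' (digit n t (l' + 1))" "delta AS (digit n t (l' + 2)) x = Some q"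
      then show ?thesis by (intro exI[of _ l'] exI[of _ "digit n t (l' + 1)"]) simp
    qed blast+
    then have ?R using h qn snoc.IH track_less by blast
    then show "mem (node 2 t l q) (foldl stp p0 (w @ [x]))" using m by simp
  qed
qed

lemma pos_T_iff: "pos_T v (foldl stp p0 w) \<longleftrightarrow> w \<in> lang AT"
  unfolding pos_T_def encode_input_simps mem_node_T code_mem_final_list[of _ cT k] lang_def
  using finals_less(2) by blast

lemma pos_S_iff: "pos_S v (foldl stp p0 w) \<longleftrightarrow> sem w \<in> sem_set (lang AS)"
proof -
  have "pos_S v (foldl stp p0 w) \<longleftrightarrow> (\<exists>t<tuple_bound v. \<exists>l<cut_bound v. Suc l < cut_bound v \<and>
      digit n t 0 = init AS \<and> track (delta AS) (digit n t) w l (digit n t (Suc l)) \<and>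
      track (delta AS) (digit n t) w (Suc l) (digit n t (l + 2)) \<and> digit n t (l + 2) \<in> finals AS)"
    unfolding pos_S_def encode_input_simps mem_node_cut code_mem_final_list[of _ cS k] Suc_eq_plus1 by blast
  then show ?thesis
    unfolding sem_in_sem_set_iff[OF dfa_of_wf[OF validS] states_dfa_of fin_shift]
    by (simp add: tuple_bound_def cut_bound_def)
qed

lemma pos_D_iff:
  assumes "w \<in> lists (Sigma_io k)"
  shows "pos_D v (foldl stp p0 w) \<longleftrightarrow> proj_i w \<in> Domain (sem_set (lang AS))"
  unfolding pos_D_def encode_input_simps mem_node_D[OF assms] code_mem_final_list[of _ cS k] Domain_sem_set lang_def
  using finals_less(1) by blast

lemma pos_useful_iff:
  assumes "w \<in> lists (Sigma_io k)"
  shows "pos_useful v (foldl stp p0 w) \<longleftrightarrow> (\<exists>u. proj_i w @ u \<in> Domain (sem_set (lang AS)))"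
proof
  assume "pos_useful v (foldl stp p0 w)"
  then obtain q q' w' where q: "q < n" "reach v 0 q q'" "q' \<in> finals AS"
    "steps (delta AS) (init AS) w' = Some q" "proj_i w' = proj_i w"
    unfolding pos_useful_def encode_input_simps mem_node_D[OF assms] code_mem_final_list[of _ cS k] by blast
  then obtain y where "steps (delta AS) q y = Some q'" using reach_iff by blast
  then have "w' @ y \<in> lang AS" using q(3,4) by (simp add: lang_def steps_append)
  moreover have "proj_i (w' @ y) = proj_i w @ proj_i y" using q(5) by simp
  ultimately show "\<exists>u. proj_i w @ u \<in> Domain (sem_set (lang AS))" unfolding Domain_sem_set by blast
next
  assume "\<exists>u. proj_i w @ u \<in> Domain (sem_set (lang AS))"
  then obtain z u where z: "z \<in> lang AS" "proj_i z = proj_i w @ u" unfolding Domain_sem_set by blast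
  then obtain w' y where w': "z = w' @ y" "proj_i w' = proj_i w" using proj_i_append_split by blast
  obtain q q' where q: "steps (delta AS) (init AS) w' = Some q" "steps (delta AS) q y = Some q'" "q' \<in> finals AS"
    using z(1) w'(1) by (auto simp: lang_def steps_append split: option.splits)
  have "q < n" using steps_less(1)[OF q(1)] .
  moreover have "q' < n" using finals_less(1)[OF q(3)] .
  moreover have "reach v 0 q q'" using q(2) reach_iff[OF \<open>q < n\<close>] by blast
  ultimately show "pos_useful v (foldl stp p0 w)"
    unfolding pos_useful_def encode_input_simps mem_node_D[OF assms] code_mem_final_list[of _ cS k]
    using q(1,3) w'(2) by blast
qed

lemma pos_reach_iff:
  assumes "X < 2 ^ M"
  shows "pos_reach v X X' \<longleftrightarrow> (\<exists>y\<in>lists ({2} \<times> {..<k}). X' = foldl stp X y)"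
proof -
  let ?r = "\<lambda>Y Y'. \<exists>x\<in>{2} \<times> {..<k}. Y' = stp Y x"
  have eq: "(\<forall>b<k. mem Y R \<and> pos_step v Y 2 b Y' \<longrightarrow> mem Y' R) \<longleftrightarrow> (mem Y R \<and> ?r Y Y' \<longrightarrow> mem Y' R)"
    if "Y' < 2 ^ M" for Y Y' R using pos_step_iff[OF that] by auto
  have "pos_reach v X X' \<longleftrightarrow> (\<forall>R<2 ^ 2 ^ M. mem X R \<and>
      (\<forall>Y<2 ^ M. \<forall>Y'<2 ^ M. mem Y R \<and> ?r Y Y' \<longrightarrow> mem Y' R) \<longrightarrow> mem X' R)"
    unfolding pos_reach_def encode_input_simps using eq by meson
  also have "\<dots> \<longleftrightarrow> ?r\<^sup>*\<^sup>* X X'"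
    by (rule closed_codes_iff_rtranclp) (use assms stp_less in auto)
  finally show ?thesis unfolding rtranclp_iff_foldl .
qed

section \<open>The coded game as an instance of the abstract game\<close>

sublocale game: sync_game k "lang AT" "sem_set (lang AS)" p0 stp "2 ^ M"
  "\<lambda>X. pos_T v X \<and> pos_S v X" "pos_D v" "pos_useful v"
proof
  show "set u \<subseteq> {..<k}" if u: "u \<in> Domain (sem_set (lang AS))" for u
  proof -
    obtain w where w: "w \<in> lang AS" "proj_i w = u" using u unfolding Domain_sem_set by blast
    then have "w \<in> lists (Sigma_io k)"
      using steps_letters[OF dfa_of_wf[OF validS], of "init AS" w] by (auto simp: lang_def)
    then have "set (proj_i w) \<subseteq> {..<k}" by (induction w) (auto simp: Sigma_io_def)
    then show ?thesis using w(2) by simp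
  qed
qed (simp_all add: p0_less stp_less pos_T_iff pos_S_iff pos_D_iff pos_useful_iff)

lemma foldl_stp_less: "X < 2 ^ M \<Longrightarrow> foldl stp X y < 2 ^ M"
  by (induction y arbitrary: X) (simp_all add: stp_less)

lemma pos_good_iff:
  assumes X: "X < 2 ^ M"
  shows "pos_good v W X \<longleftrightarrow> game.good {Y. mem Y W} X"
proof -
  have "pos_good v W X \<longleftrightarrow> (\<exists>X1<2 ^ M. \<exists>X2<2 ^ M.
     (\<exists>y\<in>lists ({2} \<times> {..<k}). X1 = foldl stp X y) \<and> (\<exists>z\<in>lists ({2} \<times> {..<k}). X2 = foldl stp X1 z) \<and>
     (pos_D v X \<longrightarrow> pos_T v X1 \<and> pos_S v X1) \<and>
     (\<forall>a<k. pos_useful v (stp X2 (1, a)) \<longrightarrow> mem (stp X2 (1, a)) W))"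
  proof -
    \<comment> \<open>A step has exactly one result below \<open>2 ^ M\<close>, so the quantifier
      over \<open>Y\<close> amounts to the value \<open>stp X2 (1, a)\<close>.\<close>
    have "(\<forall>Y<2 ^ M. pos_step v X2 1 a Y \<and> pos_useful v Y \<longrightarrow> mem Y W) \<longleftrightarrow>
        (pos_useful v (stp X2 (1, a)) \<longrightarrow> mem (stp X2 (1, a)) W)" for X2 a
      using pos_step_iff[of _ X2 1 a] stp_less[of X2 "(1, a)"] by auto
    then show ?thesis
      unfolding pos_good_def encode_input_simps using pos_reach_iff X by (simp cong: conj_cong)
  qed
  also have "\<dots> \<longleftrightarrow> game.good {Y. mem Y W} X" (is "?L \<longleftrightarrow> ?R")
  proof
    assume ?L
    then obtain X1 X2 y z where "y \<in> lists ({2} \<times> {..<k})" "X1 = foldl stp X y"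
      "z \<in> lists ({2} \<times> {..<k})" "X2 = foldl stp X1 z" "pos_D v X \<longrightarrow> pos_T v X1 \<and> pos_S v X1"
      "\<forall>a<k. pos_useful v (stp X2 (1, a)) \<longrightarrow> mem (stp X2 (1, a)) W"
      by (elim exE conjE bexE) (rule that)
    then show ?R unfolding game.good_def by (intro exI[of _ y] exI[of _ z]) simp
  next
    assume ?R
    then obtain y z where yz: "y \<in> lists ({2} \<times> {..<k})" "z \<in> lists ({2} \<times> {..<k})"
      "pos_D v X \<longrightarrow> pos_T v (foldl stp X y) \<and> pos_S v (foldl stp X y)"
      "\<forall>a<k. pos_useful v (stp (foldl stp (foldl stp X y) z) (1, a)) \<longrightarrow>
        stp (foldl stp (foldl stp X y) z) (1, a) \<in> {Y. mem Y W}"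
      unfolding game.good_def foldl_append by (elim exE conjE) (rule that)
    have l: "foldl stp X y < 2 ^ M" "foldl stp (foldl stp X y) z < 2 ^ M"
      by (intro foldl_stp_less X)+
    show ?L
      by (intro exI[of _ "foldl stp X y"] exI[of _ "foldl stp (foldl stp X y) z"] conjI
          bexI[OF refl yz(1)] bexI[OF refl yz(2)] l yz(3) yz(4)[unfolded mem_Collect_eq])
  qed
  finally show ?thesis .
qed

lemma winning_iff:
  "winning v \<longleftrightarrow> (\<exists>A. dfa_wf k A \<and> sequential A \<and> lang A \<subseteq> lang AT \<and>
     uniformization (sem_set (lang A)) (sem_set (lang AS)))"
proof -
  have "winning v \<longleftrightarrow> (\<exists>W<2 ^ 2 ^ M. mem p0 W \<and> (\<forall>X<2 ^ M. mem X W \<longrightarrow> game.good {Y. mem Y W} X))"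
    unfolding winning_def using p0_less pos_init_iff pos_good_iff by (metis (no_types, lifting))
  also have "\<dots> \<longleftrightarrow> (\<exists>W\<subseteq>{..<2 ^ M}. p0 \<in> W \<and> (\<forall>p\<in>W. game.good W p))"
  proof
    assume "\<exists>W<2 ^ 2 ^ M. mem p0 W \<and> (\<forall>X<2 ^ M. mem X W \<longrightarrow> game.good {Y. mem Y W} X)"
    then obtain W where W: "W < 2 ^ 2 ^ M" "mem p0 W" "\<forall>X<2 ^ M. mem X W \<longrightarrow> game.good {Y. mem Y W} X"
      by blast
    \<comment> \<open>All elements of the coded set lie below \<open>2 ^ M\<close>, hence the
      bounded quantifier over \<open>X\<close> covers the entire set.\<close>
    have "{Y. mem Y W} \<subseteq> {..<2 ^ M}" using mem_less W(1) by blast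
    then show "\<exists>W\<subseteq>{..<2 ^ M}. p0 \<in> W \<and> (\<forall>p\<in>W. game.good W p)"
      using W(2,3) by (intro exI[of _ "{Y. mem Y W}"]) auto
  next
    assume "\<exists>W\<subseteq>{..<2 ^ M}. p0 \<in> W \<and> (\<forall>p\<in>W. game.good W p)"
    then obtain W where W: "W \<subseteq> {..<2 ^ M}" "p0 \<in> W" "\<forall>p\<in>W. game.good W p" by blast
    then have "finite W" using finite_subset by blast
    then have m: "mem Y (set_encode W) \<longleftrightarrow> Y \<in> W" for Y by (rule mem_set_encode)
    show "\<exists>W<2 ^ 2 ^ M. mem p0 W \<and> (\<forall>X<2 ^ M. mem X W \<longrightarrow> game.good {Y. mem Y W} X)"
      using set_encode_less[OF W(1)] W(2,3) by (intro exI[of _ "set_encode W"]) (simp add: m)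
  qed
  also have "\<dots> \<longleftrightarrow> (\<exists>A. dfa_wf k A \<and> sequential A \<and> lang A \<subseteq> lang AT \<and>
     uniformization (sem_set (lang A)) (sem_set (lang AS)))"
    by (rule game.uniformizer_iff_winning_set[symmetric])
  finally show ?thesis .
qed

end

theorem theoremA1:
  shows "\<exists>f::recf. \<forall>k cS cT.
     code_valid k cS \<and> code_valid k cT \<and> finite_shift (lang (dfa_of k cS)) \<longrightarrow>
     eval f [encode_input k cS cT]
       (if (\<exists>A. dfa_wf k A \<and> sequential A \<and> lang A \<subseteq> lang (dfa_of k cT) \<and>
              uniformization (sem_set (lang A)) (sem_set (lang (dfa_of k cS))))
        then 1 else 0)"
proof -
  obtain f where f: "\<And>v. eval f [v] (if winning v then 1 else 0)" using winning_recf by blast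
  show ?thesis
  proof (intro exI[of _ f] allI impI, elim conjE)
    fix k cS cT
    assume "code_valid k cS" "code_valid k cT" "finite_shift (lang (dfa_of k cS))"
    then interpret uniformization_input k cS cT by unfold_locales
    show "eval f [encode_input k cS cT]
       (if (\<exists>A. dfa_wf k A \<and> sequential A \<and> lang A \<subseteq> lang (dfa_of k cT) \<and>
              uniformization (sem_set (lang A)) (sem_set (lang (dfa_of k cS))))
        then 1 else 0)"
      using f[of v] unfolding winning_iff .
  qed
qed
end
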